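(* Let $k\geq 4$ and $n\geq 71k^2$. If $\mathcal F\subset\binom{[n]}{k}$ is intersecting, then \[ \gamma_3(\mathcal F)\leq 3\binom{n-7}{k-4}+108k\binom{n-8}{k-5}. \]
   Context: A family is intersecting if any two of its members intersect. For $S\subset[n]$, $\mathcal F(\overline S)=\{F\in\mathcal F: F\cap S=\emptyset\}$, and $\gamma_3(\mathcal F)=\min_{S\in\binom{[n]}{3}}|\mathcal F(\overline S)|$. Binomial coefficients $\binom{a}{b}$ are $0$ when $b<0$. *)

theory Defs
  imports Main
begin

definition intersecting :: "nat set set \<Rightarrow> bool" where
  "intersecting F \<longleftrightarrow> (\<forall>A\<in>F. \<forall>B\<in>F. A \<inter> B \<noteq> {})"

definition avoid :: "nat set set \<Rightarrow> nat set \<Rightarrow> nat set set" where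
  "avoid F S = {A \<in> F. A \<inter> S = {}}"

definition gamma3 :: "nat \<Rightarrow> nat set set \<Rightarrow> nat" where
  "gamma3 n F = Min {card (avoid F S) | S. S \<subseteq> {1..n} \<and> card S = 3}"

definition binom :: "nat \<Rightarrow> int \<Rightarrow> nat" where
  "binom a b = (if b < 0 then 0 else a choose nat b)"

end

theory Submission
  imports Defs
begin

text \<open>
  We may assume that \<open>F\<close> is a maximal intersecting family without a transversal of size 3. Let \<open>l\<close> be
  the least number for which the transversals of \<open>F\<close> of size at most \<open>l\<close> cannot be covered by 3
  points. Choose a triple \<open>S\<close> covering all smaller transversals. Branching four times over transversals
  of size at most \<open>l\<close>, then over members of \<open>F\<close>, bounds the number of members avoiding \<open>S\<close> by
  \<open>l\<^sup>4 k\<^bsup>l-4\<^esup>\<close> times the binomial coefficient for \<open>l\<close>-sets, which for \<open>l \<ge> 6\<close> is below the first binomial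
  coefficient because \<open>n \<ge> 71 k\<^sup>2\<close>; for \<open>l = 5\<close> a suitable \<open>S\<close> saves the missing constant factor.

  For \<open>l = 4\<close> the transversals of size 4 form an intersecting family, and the main term comes from the
  following fact: a nonempty intersecting family of 4-sets has a member \<open>A\<close> and a triple \<open>S \<subseteq> A\<close> avoided by
  at most 3 members. If instead every such triple is avoided by at least 4 members, then
  successively no triple lies in three members, no triple lies in two, and no pair lies in two. At
  that point, for members \<open>A\<close> and \<open>C\<close> meeting only in \<open>a\<close>, the four members meeting \<open>A\<close> only in a second point
  \<open>x\<close> must pass through different points of \<open>C - {a}\<close>, which has only three.
\<close>

section \<open>Heavy intersecting families of 4-sets\<close>

lemma card_ge_2_obtain:
  assumes "2 \<le> card X"
  obtains a b where "a \<in> X" "b \<in> X" "a \<noteq> b"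
  using assms by (auto simp: numeral_eq_Suc card_le_Suc_iff)

lemma card_ge_3_obtain:
  assumes "3 \<le> card X"
  obtains a b c where "a \<in> X" "b \<in> X" "c \<in> X" "a \<noteq> b" "a \<noteq> c" "b \<noteq> c"
  using assms by (auto simp: numeral_eq_Suc card_le_Suc_iff)

lemma card_ge_4_obtain:
  assumes "4 \<le> card X"
  obtains a b c d where "a \<in> X" "b \<in> X" "c \<in> X" "d \<in> X" "distinct [a, b, c, d]"
  using assms by (auto simp: numeral_eq_Suc card_le_Suc_iff)

lemma obtain_separated:
  assumes "2 \<le> card N" "\<And>B. B \<in> N \<Longrightarrow> v \<in> B \<or> w \<in> B"
    and "\<And>B B'. B \<in> N \<Longrightarrow> B' \<in> N \<Longrightarrow> v \<in> B \<Longrightarrow> v \<in> B' \<Longrightarrow> B = B'"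
    and "\<And>B B'. B \<in> N \<Longrightarrow> B' \<in> N \<Longrightarrow> w \<in> B \<Longrightarrow> w \<in> B' \<Longrightarrow> B = B'"
  obtains P Q where "P \<in> N" "v \<in> P" "w \<notin> P" "Q \<in> N" "w \<in> Q" "v \<notin> Q"
proof -
  obtain A B where "A \<in> N" "B \<in> N" "A \<noteq> B" using assms(1) by (rule card_ge_2_obtain)
  then show ?thesis using assms(2-4)[of A] assms(2-4)[of B] that by metis
qed

lemma card_pair_le: "card {a, b} \<le> 2"
  and card_triple_le: "card {a, b, c} \<le> 3"
  by (simp_all add: card_insert_if)

text \<open>A hypothetical counterexample to \<open>exists_light_triple\<close>. Nonemptiness is
  left out, so the contradiction takes the form \<open>family_empty\<close>.\<close>

locale heavy_family =
  fixes \<A> :: "'a set set"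
  assumes finite_family: "finite \<A>"
    and card_member: "A \<in> \<A> \<Longrightarrow> card A = 4"
    and meet: "A \<in> \<A> \<Longrightarrow> B \<in> \<A> \<Longrightarrow> A \<inter> B \<noteq> {}"
    and heavy: "A \<in> \<A> \<Longrightarrow> S \<subseteq> A \<Longrightarrow> card S = 3 \<Longrightarrow> 4 \<le> card {B \<in> \<A>. B \<inter> S = {}}"
begin

definition off :: "'a \<Rightarrow> 'a \<Rightarrow> 'a \<Rightarrow> 'a set set" where
  "off a b c = {B \<in> \<A>. a \<notin> B \<and> b \<notin> B \<and> c \<notin> B}"

definition up :: "'a \<Rightarrow> 'a \<Rightarrow> 'a \<Rightarrow> 'a set set" where
  "up a b c = {B \<in> \<A>. a \<in> B \<and> b \<in> B \<and> c \<in> B}"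

lemma finite_off [simp]: "finite (off a b c)"
  and finite_up [simp]: "finite (up a b c)"
  using finite_family by (auto simp: off_def up_def)

lemma distinct_member: "{a, b, c, d} \<in> \<A> \<Longrightarrow> distinct [a, b, c, d]"
  using card_member[of "{a, b, c, d}"]
  by (auto simp: insert_commute card_insert_if split: if_splits)

lemma finite_member: "B \<in> \<A> \<Longrightarrow> finite B"
  using card_member[of B] by (metis card.infinite zero_neq_numeral)

lemma member_eq:
  assumes "B \<in> \<A>" "a \<in> B" "b \<in> B" "c \<in> B" "d \<in> B" "distinct [a, b, c, d]"
  shows "B = {a, b, c, d}"
proof -
  have "card {a, b, c, d} = 4" using assms by auto
  then show ?thesis
    using assms card_subset_eq[of B "{a, b, c, d}"] card_member[of B] finite_member[of B] by auto
qed

lemma no_five: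
  assumes "B \<in> \<A>" "a \<in> B" "b \<in> B" "c \<in> B" "d \<in> B" "e \<in> B" "distinct [a, b, c, d, e]"
  shows False
  using member_eq[of B a b c d] assms by auto

lemma hit: "{a, b, c, d} \<in> \<A> \<Longrightarrow> B \<in> \<A> \<Longrightarrow> a \<in> B \<or> b \<in> B \<or> c \<in> B \<or> d \<in> B"
  using meet[of "{a, b, c, d}" B] by blast

lemma up_eq:
  assumes "B \<in> up a b c" "distinct [a, b, c]"
  obtains d where "B = {a, b, c, d}" "distinct [a, b, c, d]"
proof -
  have B: "B \<in> \<A>" "a \<in> B" "b \<in> B" "c \<in> B" using assms by (auto simp: up_def)
  have "card {a, b, c} = 3" using assms by auto
  then have "B \<noteq> {a, b, c}" using card_member[OF B(1)] by auto
  then obtain d where "d \<in> B" "d \<notin> {a, b, c}" using B by auto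
  then show ?thesis using that[of d] member_eq[of B a b c d] B assms(2) by auto
qed

lemma pair_eq:
  assumes "B \<in> \<A>" "a \<in> B" "b \<in> B" "a \<noteq> b"
  obtains c d where "B = {a, b, c, d}" "distinct [a, b, c, d]"
proof -
  have "card {a, b} = 2" using assms by auto
  then have "B \<noteq> {a, b}" using card_member[OF assms(1)] by auto
  then obtain c where c: "c \<in> B" "c \<notin> {a, b}" using assms by auto
  then have "B \<in> up a b c" using assms by (auto simp: up_def)
  then obtain d where "B = {a, b, c, d}" "distinct [a, b, c, d]"
    using up_eq[of B a b c] c assms(4) by (metis distinct_length_2_or_more distinct_singleton insertCI)
  then show ?thesis using that by blast
qed

lemma card_off: "{a, b, c, d} \<in> \<A> \<Longrightarrow> 4 \<le> card (off a b c)"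
proof -
  assume A: "{a, b, c, d} \<in> \<A>"
  have "card {a, b, c} = 3" using distinct_member[OF A] by auto
  then have "4 \<le> card {B \<in> \<A>. B \<inter> {a, b, c} = {}}" by (intro heavy[OF A]) auto
  moreover have "{B \<in> \<A>. B \<inter> {a, b, c} = {}} = off a b c" by (auto simp: off_def)
  ultimately show ?thesis by simp
qed

lemma off_cover: "{a, b, c, d} \<in> \<A> \<Longrightarrow> off a b c \<subseteq> X \<Longrightarrow> finite X \<Longrightarrow> 4 \<le> card X"
  using card_off card_mono order_trans by metis

lemma off_new:
  assumes "{a, b, c, d} \<in> \<A>"
  obtains B where "B \<in> off a b c" "B \<noteq> X" "B \<noteq> Y" "B \<noteq> Z"
proof -
  have "\<not> off a b c \<subseteq> {X, Y, Z}"
  proof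
    assume "off a b c \<subseteq> {X, Y, Z}"
    then have "4 \<le> card {X, Y, Z}" by (intro off_cover[OF assms]) auto
    then show False using card_triple_le[of X Y Z] by linarith
  qed
  then show ?thesis using that by blast
qed

section \<open>Triples contained in at most two members\<close>

lemma no_four_extensions:
  assumes "{a, b, c, x1} \<in> \<A>" "{a, b, c, x2} \<in> \<A>" "{a, b, c, x3} \<in> \<A>" "{a, b, c, x4} \<in> \<A>"
    "distinct [x1, x2, x3, x4]"
  shows False
proof -
  \<comment> \<open>A member missing \<open>a\<close>, \<open>b\<close>, \<open>c\<close> can meet
    the four given members only in \<open>x1\<close>, ..., \<open>x4\<close>, so it consists of
    these four points.\<close>
  have "off a b c \<subseteq> {{x1, x2, x3, x4}}"
  proof
    fix B assume "B \<in> off a b c"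
    then have B: "B \<in> \<A>" "a \<notin> B" "b \<notin> B" "c \<notin> B" by (auto simp: off_def)
    then have "x1 \<in> B" "x2 \<in> B" "x3 \<in> B" "x4 \<in> B" using hit assms(1-4) by blast+
    then show "B \<in> {{x1, x2, x3, x4}}" using member_eq[OF B(1)] assms(5) by blast
  qed
  then show False using off_cover[OF assms(1), of "{{x1, x2, x3, x4}}"] by simp
qed

lemma no_three_extensions:
  assumes A: "{a, b, c, x1} \<in> \<A>" "{a, b, c, x2} \<in> \<A>" "{a, b, c, x3} \<in> \<A>"
  shows "x1 = x2 \<or> x1 = x3 \<or> x2 = x3"
proof (rule ccontr)
  assume "\<not> ?thesis"
  then have D: "distinct [x1, x2, x3]" by auto
  \<comment> \<open>The roles turn around: heaviness now produces four extensions of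
    \<open>{x1, x2, x3}\<close>, which \<open>no_four_extensions\<close> forbids.\<close>
  have "off a b c \<subseteq> up x1 x2 x3" using hit A by (fastforce simp: off_def up_def)
  then have "4 \<le> card (up x1 x2 x3)" using off_cover A(1) by auto
  then obtain B1 B2 B3 B4 where B: "B1 \<in> up x1 x2 x3" "B2 \<in> up x1 x2 x3" "B3 \<in> up x1 x2 x3"
      "B4 \<in> up x1 x2 x3" "distinct [B1, B2, B3, B4]"
    using card_ge_4_obtain by blast
  obtain y1 y2 y3 y4 where "B1 = {x1, x2, x3, y1}" "B2 = {x1, x2, x3, y2}"
      "B3 = {x1, x2, x3, y3}" "B4 = {x1, x2, x3, y4}"
    using up_eq[OF B(1) D] up_eq[OF B(2) D] up_eq[OF B(3) D] up_eq[OF B(4) D] by metis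
  note y = this
  have "distinct [y1, y2, y3, y4]" using B(5) unfolding y by auto
  moreover have "{x1, x2, x3, y1} \<in> \<A>" "{x1, x2, x3, y2} \<in> \<A>" "{x1, x2, x3, y3} \<in> \<A>"
    "{x1, x2, x3, y4} \<in> \<A>" using B(1-4) y by (auto simp: up_def)
  ultimately show False using no_four_extensions by blast
qed

lemma up_three:
  assumes "B1 \<in> up a b c" "B2 \<in> up a b c" "B3 \<in> up a b c" "distinct [a, b, c]"
  shows "B1 = B2 \<or> B1 = B3 \<or> B2 = B3"
proof -
  obtain y1 y2 y3 where "B1 = {a, b, c, y1}" "B2 = {a, b, c, y2}" "B3 = {a, b, c, y3}"
    using up_eq[OF assms(1,4)] up_eq[OF assms(2,4)] up_eq[OF assms(3,4)] by metis
  then show ?thesis using no_three_extensions[of a b c y1 y2 y3] assms by (auto simp: up_def)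
qed

text \<open>\<open>p\<close> and \<open>q\<close> already use up the two extensions that the triple
  may have.\<close>

lemma up_two:
  assumes "{a, b, c, p} \<in> \<A>" "{a, b, c, q} \<in> \<A>" "p \<noteq> q" "B \<in> \<A>" "a \<in> B" "b \<in> B" "c \<in> B"
  shows "p \<in> B \<or> q \<in> B"
proof -
  have "distinct [a, b, c]" using distinct_member[OF assms(1)] by auto
  moreover have "B \<in> up a b c" using assms by (auto simp: up_def)
  ultimately obtain r where r: "B = {a, b, c, r}" by (meson up_eq)
  then have "p = r \<or> q = r" using no_three_extensions[of a b c p q r] assms by auto
  then show ?thesis using r by auto
qed

lemma card_up: "distinct [a, b, c] \<Longrightarrow> card (up a b c) \<le> 2"
proof (rule ccontr)
  assume "distinct [a, b, c]" "\<not> card (up a b c) \<le> 2"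
  then show False using card_ge_3_obtain[of "up a b c"] up_three[of _ a b c]
    by (metis not_less_eq_eq numeral_2_eq_2 numeral_3_eq_3)
qed

end

section \<open>Members avoiding a triple that has two extensions\<close>

lemma card_3_third:
  assumes "card T = 3" "t \<in> T" "t' \<in> T" "t \<noteq> t'"
  obtains t'' where "T = {t, t', t''}" "distinct [t, t', t'']"
proof -
  have "card (T - {t, t'}) = 1" using assms by (subst card_Diff_subset) auto
  then obtain t'' where "T - {t, t'} = {t''}" using card_1_singletonE by blast
  then show ?thesis using that[of t''] assms by auto
qed

context heavy_family begin

definition twice :: "'a \<Rightarrow> 'a \<Rightarrow> 'a \<Rightarrow> 'a set \<Rightarrow> bool" where
  "twice a b c T \<longleftrightarrow> (\<exists>t\<in>T. \<exists>t'\<in>T. t \<noteq> t' \<and> {a, b, c, t} \<in> \<A> \<and> {a, b, c, t'} \<in> \<A>)"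

text \<open>Two subsets of the 3-set \<open>T\<close>, each with at least two points, share a
  point.\<close>

lemma twice_common:
  assumes "twice a b c T" "twice a' b' c' T" "card T = 3"
  obtains t where "t \<in> T" "{a, b, c, t} \<in> \<A>" "{a', b', c', t} \<in> \<A>"
proof -
  obtain t t' where t: "t \<in> T" "t' \<in> T" "t \<noteq> t'" "{a, b, c, t} \<in> \<A>" "{a, b, c, t'} \<in> \<A>"
    using assms(1) by (auto simp: twice_def)
  obtain s s' where s: "s \<in> T" "s' \<in> T" "s \<noteq> s'" "{a', b', c', s} \<in> \<A>" "{a', b', c', s'} \<in> \<A>"
    using assms(2) by (auto simp: twice_def)
  obtain t'' where "T = {t, t', t''}" using card_3_third[OF assms(3) t(1-3)] by metis
  then have "s = t \<or> s = t' \<or> s' = t \<or> s' = t'" using s(1-3) by blast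
  then show ?thesis using that t s by metis
qed

end

text \<open>
  The members avoiding \<open>T\<close> are the sets \<open>{x, y} \<union> e\<close>, where \<open>e\<close> runs through the edges of a graph
  disjoint from \<open>T\<close>. Triples have degree at most 2, so this graph has maximum degree 2, and it has
  at least 4 edges. The lemmas below leave only the 4-cycle, and finally rule that out too.
\<close>
locale forked_triple = heavy_family +
  fixes T x y
  assumes card_T: "card T = 3" and Tx: "insert x T \<in> \<A>" and Ty: "insert y T \<in> \<A>" and xy: "x \<noteq> y"
begin

lemma x_T: "x \<notin> T" and y_T: "y \<notin> T"
  using card_member[OF Tx] card_member[OF Ty] card_T by (auto simp: insert_absorb)

lemma hit_T: "B \<in> \<A> \<Longrightarrow> x \<notin> B \<or> y \<notin> B \<Longrightarrow> \<exists>t\<in>T. t \<in> B"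
  using meet[OF Tx, of B] meet[OF Ty, of B] by auto

lemma off_T: "B \<in> \<A> \<Longrightarrow> B \<inter> T = {} \<Longrightarrow> x \<in> B \<and> y \<in> B"
  using hit_T by blast

lemma off_fork:
  assumes "{x, y, u, v} \<in> \<A>" "{x, y, u, w} \<in> \<A>" "{x, y, c, d} \<in> \<A>" "B \<in> off x y u"
  shows "v \<in> B" "w \<in> B" "c \<in> B \<or> d \<in> B"
  using hit[OF assms(1)] hit[OF assms(2)] hit[OF assms(3)] assms(4) by (auto simp: off_def)

text \<open>At least four members miss \<open>x\<close>, \<open>y\<close>, \<open>u\<close>; they
  contain \<open>v\<close>, \<open>w\<close> and one of \<open>c\<close>, \<open>d\<close>. At most
  two contain \<open>v\<close>, \<open>w\<close>, \<open>d\<close>, so two contain \<open>v\<close>,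
  \<open>w\<close>, \<open>c\<close>, and each of these has its fourth point in \<open>T\<close>
  because it misses \<open>x\<close>.\<close>

lemma off_fork_twice:
  assumes m: "{x, y, u, v} \<in> \<A>" "{x, y, u, w} \<in> \<A>" "{x, y, c, d} \<in> \<A>"
    and d: "distinct [v, w, c, d]" "T \<inter> {v, w, c, d} = {}"
  shows "twice v w c T" "twice v w d T"
proof -
  have *: "twice v w c T" if m: "{x, y, u, v} \<in> \<A>" "{x, y, u, w} \<in> \<A>" "{x, y, c, d} \<in> \<A>"
    and d: "distinct [v, w, c, d]" "T \<inter> {v, w, c, d} = {}" for c d
  proof -
    let ?P = "{B \<in> off x y u. c \<in> B}" and ?Q = "{B \<in> off x y u. d \<in> B}"
    note off = off_fork[OF m]
    have "?Q \<subseteq> up v w d" using off by (auto simp: off_def up_def)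
    then have "card ?Q \<le> card (up v w d)" by (intro card_mono) auto
    also have "\<dots> \<le> 2" using d by (intro card_up) auto
    finally have Q: "card ?Q \<le> 2" .
    have "off x y u \<subseteq> ?P \<union> ?Q" using off by blast
    then have "4 \<le> card (?P \<union> ?Q)" using off_cover m(1) by auto
    also have "\<dots> \<le> card ?P + card ?Q" by (rule card_Un_le)
    finally have "2 \<le> card ?P" using Q by simp
    then obtain B1 B2 where B: "B1 \<in> ?P" "B2 \<in> ?P" "B1 \<noteq> B2" by (rule card_ge_2_obtain)
    have ex: "\<exists>t\<in>T. B = {v, w, c, t}" if "B \<in> ?P" for B
    proof -
      have B: "B \<in> \<A>" "v \<in> B" "w \<in> B" "c \<in> B" "x \<notin> B" using off that by (auto simp: off_def)
      then obtain t where t: "t \<in> T" "t \<in> B" using hit_T by blast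
      then have "distinct [v, w, c, t]" using d by auto
      then show ?thesis using member_eq[OF B(1-4) t(2)] t(1) by blast
    qed
    obtain t1 t2 where t: "t1 \<in> T" "t2 \<in> T" "B1 = {v, w, c, t1}" "B2 = {v, w, c, t2}"
      using ex B by meson
    then have "t1 \<noteq> t2" using B by auto
    then show ?thesis unfolding twice_def using t B by (auto simp: off_def)
  qed
  show "twice v w c T" using * m d .
  have "{x, y, d, c} \<in> \<A>" using m(3) by (simp add: insert_commute)
  then show "twice v w d T" using *[of d c] m(1,2) d by auto
qed

end

section \<open>Excluding a path with four edges\<close>

text \<open>The graph of \<open>T\<close> contains the path \<open>w - u - v - c - d\<close>.\<close>
locale forked_path = forked_triple +
  fixes w u v c d
  assumes wu: "{x, y, w, u} \<in> \<A>" and uv: "{x, y, u, v} \<in> \<A>"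
    and vc: "{x, y, v, c} \<in> \<A>" and cd: "{x, y, c, d} \<in> \<A>"
    and path_distinct: "distinct [w, u, v, c, d]" and path_T: "T \<inter> {w, u, v, c, d} = {}"
begin

lemma all_distinct: "distinct [x, y, w, u, v, c, d]"
  using distinct_member[OF wu] distinct_member[OF vc] distinct_member[OF cd] path_distinct by auto

lemma uw: "{x, y, u, w} \<in> \<A>" and cv: "{x, y, c, v} \<in> \<A>"
  using wu vc by (auto simp: insert_commute)

text \<open>Reversing the path and, in \<open>swap\<close>, exchanging \<open>x\<close> and
  \<open>y\<close> are the symmetries used in \<open>impossible\<close> and
  \<open>half\<close>.\<close>

lemma reflect: "forked_path \<A> T x y d c v u w"
  using wu uv vc cd path_distinct path_T
  by unfold_locales (auto simp: insert_commute)

lemma swap: "forked_path \<A> T y x w u v c d"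
  using wu uv vc cd path_distinct path_T Tx Ty card_T xy
  by unfold_locales (auto simp: insert_commute)

lemma twices: "twice v w c T" "twice v w d T" "twice v d u T"
proof -
  show "twice v w c T" "twice v w d T"
    using off_fork_twice[OF uv uw cd] path_distinct path_T by auto
  show "twice v d u T"
    using off_fork_twice[OF cv cd uw] path_distinct path_T by auto
qed

text \<open>Otherwise the members missing \<open>t\<close>, \<open>t'\<close>, \<open>x\<close> all
  contain \<open>t''\<close> and \<open>z\<close>. At most two of them contain \<open>y\<close>, and
  the others are forced onto \<open>{t'', z, u, c}\<close>; three members are too few for the heavy
  triple \<open>{t, t', x}\<close>.\<close>

lemma fourth_vertex:
  assumes T: "T = {t, t', t''}" "distinct [t, t', t'']"
    and m: "{v, w, c, t} \<in> \<A>" "{v, w, c, t'} \<in> \<A>" "{t, t', x, z} \<in> \<A>"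
    and z: "z \<notin> {y, t'', v, w, c}"
  shows "z = u \<or> z = d"
proof (rule ccontr)
  assume "\<not> ?thesis"
  then have D: "distinct [t'', z, w, u, v, c, d]" using z T path_distinct path_T by auto
  have D': "distinct [t'', z, y]" using z T y_T by auto
  have "off t t' x \<subseteq> up t'' z y \<union> {{t'', z, u, c}}"
  proof
    fix B assume "B \<in> off t t' x"
    then have B: "B \<in> \<A>" "t \<notin> B" "t' \<notin> B" "x \<notin> B" by (auto simp: off_def)
    have t: "t'' \<in> B" using hit_T[of B] B T by auto
    have zB: "z \<in> B" using hit[OF m(3) B(1)] B by auto
    show "B \<in> up t'' z y \<union> {{t'', z, u, c}}"
    proof (cases "y \<in> B")
      case True then show ?thesis using B t zB by (auto simp: up_def)
    next
      case False
      \<comment> \<open>Without \<open>u\<close>, the fork at \<open>u\<close> would put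
        \<open>v\<close>, \<open>w\<close> and one of \<open>c\<close>, \<open>d\<close> into
        \<open>B\<close> besides \<open>t''\<close> and \<open>z\<close>: five points.\<close>
      have uB: "u \<in> B"
      proof (rule ccontr)
        assume "u \<notin> B"
        then have "B \<in> off x y u" using B False by (auto simp: off_def)
        from off_fork[OF uv uw cd this] show False
          using no_five[OF B(1) t zB, of v w c] no_five[OF B(1) t zB, of v w d] D by auto
      qed
      have "v \<in> B \<or> w \<in> B \<or> c \<in> B" using hit[OF m(1) B(1)] B by auto
      moreover have "c \<in> B \<or> d \<in> B" using hit[OF cd B(1)] B False by auto
      ultimately have "c \<in> B"
        using no_five[OF B(1) t zB uB, of v d] no_five[OF B(1) t zB uB, of w d] D by auto
      then show ?thesis using member_eq[OF B(1) t zB uB] D by auto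
    qed
  qed
  then have "4 \<le> card (up t'' z y \<union> {{t'', z, u, c}})" using off_cover m(3) by auto
  also have "\<dots> \<le> card (up t'' z y) + card {{t'', z, u, c}}" by (rule card_Un_le)
  also have "\<dots> \<le> 3" using card_up[OF D'] by auto
  finally show False by simp
qed

end

context forked_path begin

text \<open>A member missing \<open>t\<close>, \<open>t'\<close>, \<open>u\<close> contains
  \<open>x\<close> and \<open>y\<close>. By the degree bounds it is \<open>{x, y, v, c}\<close>,
  \<open>{x, y, c, d}\<close> or the one further member through \<open>x\<close>, \<open>y\<close>,
  \<open>w\<close>, so there are at most three.\<close>

lemma not_both_inner:
  assumes T: "T = {t, t', t''}" "distinct [t, t', t'']"
    and m: "{v, w, c, t} \<in> \<A>" "{v, w, d, t} \<in> \<A>" "{t, t', x, u} \<in> \<A>" "{t, t', y, u} \<in> \<A>"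
  shows False
proof -
  let ?R = "up x y w - {{x, y, w, u}}"
  have D: "distinct [x, y, w]" "distinct [x, y, v, c, d]" using all_distinct by auto
  have "off t t' u \<subseteq> {{x, y, v, c}, {x, y, c, d}} \<union> ?R"
  proof
    fix B assume "B \<in> off t t' u"
    then have B: "B \<in> \<A>" "t \<notin> B" "t' \<notin> B" "u \<notin> B" by (auto simp: off_def)
    have xB: "x \<in> B" and yB: "y \<in> B" using hit[OF m(3) B(1)] hit[OF m(4) B(1)] B by auto
    have h: "v \<in> B \<or> w \<in> B \<or> c \<in> B \<and> d \<in> B"
      using hit[OF m(1) B(1)] hit[OF m(2) B(1)] B by auto
    show "B \<in> {{x, y, v, c}, {x, y, c, d}} \<union> ?R"
    proof (cases "w \<in> B")
      case True then show ?thesis using B xB yB by (auto simp: up_def)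
    next
      case w: False
      show ?thesis
      proof (cases "v \<in> B")
        case True
        have vu: "{x, y, v, u} \<in> \<A>" using uv by (simp add: insert_commute)
        have "c \<in> B" using up_two[OF vu vc _ B(1) xB yB True] B(4) all_distinct by auto
        then have "B = {x, y, v, c}" using member_eq[OF B(1) xB yB True] D by auto
        then show ?thesis by simp
      next
        case False
        then have "B = {x, y, c, d}" using h w member_eq[OF B(1) xB yB] D by auto
        then show ?thesis by simp
      qed
    qed
  qed
  moreover have "{t, t', u, x} \<in> \<A>" using m(3) by (simp add: insert_commute)
  ultimately have "4 \<le> card ({{x, y, v, c}, {x, y, c, d}} \<union> ?R)" by (intro off_cover) auto
  also have "\<dots> \<le> card {{x, y, v, c}, {x, y, c, d}} + card ?R" by (rule card_Un_le)
  also have "card ?R = card (up x y w) - 1" using wu by (intro card_Diff_singleton) (auto simp: up_def)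
  also have "card {{x, y, v, c}, {x, y, c, d}} + (card (up x y w) - 1) \<le> 3"
    using card_up[OF D(1)] card_pair_le[of "{x, y, v, c}" "{x, y, c, d}"] by linarith
  finally show False by simp
qed

text \<open>A fourth member missing \<open>t\<close>, \<open>t'\<close>, \<open>d\<close> contains
  \<open>x\<close> and \<open>y\<close>. The path uses up the degrees of \<open>v\<close> and
  \<open>c\<close>, so it contains \<open>w\<close>, and then two points of \<open>T\<close> as
  well, five in all.\<close>

lemma not_both_end:
  assumes T: "T = {t, t', t''}" "distinct [t, t', t'']"
    and m: "{v, w, c, t} \<in> \<A>" "{t, t', x, d} \<in> \<A>" "{t, t', y, d} \<in> \<A>"
  shows False
proof -
  let ?X = "{{x, y, u, v}, {x, y, v, c}, {x, y, w, u}}"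
  have "{t, t', d, x} \<in> \<A>" using m(2) by (simp add: insert_commute)
  then obtain B where "B \<in> off t t' d" and "B \<noteq> {x, y, u, v}" "B \<noteq> {x, y, v, c}" "B \<noteq> {x, y, w, u}"
    by (rule off_new)
  then have new: "B \<notin> ?X" and "B \<in> off t t' d" by blast+
  then have B: "B \<in> \<A>" "t \<notin> B" "t' \<notin> B" "d \<notin> B" by (auto simp: off_def)
  have xB: "x \<in> B" and yB: "y \<in> B" using hit[OF m(2) B(1)] hit[OF m(3) B(1)] B by auto
  have v: "v \<notin> B"
  proof
    assume "v \<in> B"
    have "{x, y, v, u} \<in> \<A>" using uv by (simp add: insert_commute)
    then have "u \<in> B \<or> c \<in> B" using up_two[OF _ vc _ B(1) xB yB \<open>v \<in> B\<close>] all_distinct by auto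
    then have "B = {x, y, u, v} \<or> B = {x, y, v, c}"
      using member_eq[OF B(1) xB yB _ \<open>v \<in> B\<close>, of u] member_eq[OF B(1) xB yB \<open>v \<in> B\<close>, of c]
        all_distinct by auto
    then show False using new by blast
  qed
  have c: "c \<notin> B"
  proof
    assume "c \<in> B"
    then show False using up_two[OF cv cd _ B(1) xB yB] v B(4) all_distinct by auto
  qed
  have w: "w \<in> B" using hit[OF m(1) B(1)] B v c by auto
  have "u \<notin> B"
  proof
    assume "u \<in> B"
    then have "B = {x, y, w, u}" using member_eq[OF B(1) xB yB w] all_distinct by auto
    then show False using new by blast
  qed
  moreover obtain r r' where r: "r \<in> T" "r' \<in> T" "r \<noteq> r'" "{v, d, u, r} \<in> \<A>" "{v, d, u, r'} \<in> \<A>"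
    using twices(3) by (auto simp: twice_def)
  ultimately have "r \<in> B" "r' \<in> B"
    using hit[OF r(4) B(1)] hit[OF r(5) B(1)] B v by auto
  then show False using no_five[OF B(1) xB yB w] r all_distinct path_T x_T y_T by auto
qed

text \<open>Without this member, those missing \<open>t\<close>, \<open>t'\<close>, \<open>x\<close>
  would be at most two through \<open>t''\<close>, \<open>u\<close>, \<open>y\<close> and the set
  \<open>{t'', u, d, c}\<close>, again only three.\<close>

lemma third_point:
  assumes T: "T = {t, t', t''}" "distinct [t, t', t'']"
    and m: "{v, w, c, t} \<in> \<A>" "{t, t', x, u} \<in> \<A>" "{t, t', y, d} \<in> \<A>"
  shows "{v, d, u, t''} \<in> \<A>"
proof (rule ccontr)
  assume new: "{v, d, u, t''} \<notin> \<A>"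
  have D: "distinct [t'', u, y]" "distinct [t'', u, d, v, w, c]"
    using T all_distinct path_T y_T by auto
  have "off t t' x \<subseteq> up t'' u y \<union> {{t'', u, d, c}}"
  proof
    fix B assume "B \<in> off t t' x"
    then have B: "B \<in> \<A>" "t \<notin> B" "t' \<notin> B" "x \<notin> B" by (auto simp: off_def)
    have t: "t'' \<in> B" using hit_T[of B] B T by auto
    have u: "u \<in> B" using hit[OF m(2) B(1)] B by auto
    show "B \<in> up t'' u y \<union> {{t'', u, d, c}}"
    proof (cases "y \<in> B")
      case True then show ?thesis using B t u by (auto simp: up_def)
    next
      case False
      then have d: "d \<in> B" using hit[OF m(3) B(1)] B by auto
      have "v \<notin> B"
      proof
        assume "v \<in> B"
        then have "B = {t'', u, d, v}" using member_eq[OF B(1) t u d] D by auto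
        then show False using new B by (simp add: insert_commute)
      qed
      then have "c \<in> B" using hit[OF vc B(1)] B False by auto
      then show ?thesis using member_eq[OF B(1) t u d] D by auto
    qed
  qed
  then have "4 \<le> card (up t'' u y \<union> {{t'', u, d, c}})" using off_cover m(2) by auto
  also have "\<dots> \<le> card (up t'' u y) + card {{t'', u, d, c}}" by (rule card_Un_le)
  also have "\<dots> \<le> 3" using card_up[OF D(1)] by auto
  finally show False by simp
qed

text \<open>One half of the contradiction; the same statement for the reversed path is incompatible
  with it. Members missing \<open>v\<close>, \<open>w\<close>, \<open>c\<close> contain
  \<open>t\<close>, \<open>t'\<close> and one of \<open>x\<close>, \<open>y\<close>. Deleting the
  two members that define the fork leaves \<open>{t, t', x, z}\<close> and
  \<open>{t, t', y, z'}\<close> with \<open>z\<close>, \<open>z'\<close> in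
  \<open>{u, d}\<close>.\<close>

lemma half:
  "\<exists>t t' t''. T = {t, t', t''} \<and> distinct [t, t', t''] \<and> {v, w, c, t} \<in> \<A> \<and> {v, w, c, t'} \<in> \<A> \<and>
     {v, w, d, t} \<in> \<A> \<and> {v, w, d, t'} \<in> \<A> \<and> {v, d, u, t''} \<in> \<A>"
proof -
  interpret sw: forked_path \<A> T y x w u v c d by (rule swap)
  obtain t t' where t: "t \<in> T" "t' \<in> T" "t \<noteq> t'" and m: "{v, w, c, t} \<in> \<A>" "{v, w, c, t'} \<in> \<A>"
    using twices(1) by (auto simp: twice_def)
  obtain t'' where T: "T = {t, t', t''}" "distinct [t, t', t'']"
    using card_3_third[OF card_T t] by blast
  have Tx': "{t, t', x, t''} \<in> \<A>" and Ty': "{t, t', y, t''} \<in> \<A>"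
    using Tx Ty T by (auto simp: insert_commute)
  have D: "distinct [t, t', x]" "distinct [t, t', y]" using T x_T y_T by auto
  have N: "x \<in> B \<and> t \<in> B \<and> t' \<in> B \<or> y \<in> B \<and> t \<in> B \<and> t' \<in> B" if "B \<in> off v w c" for B
  proof -
    have B: "B \<in> \<A>" "v \<notin> B" "w \<notin> B" "c \<notin> B" using that by (auto simp: off_def)
    then show ?thesis using hit[OF m(1) B(1)] hit[OF m(2) B(1)] hit[OF vc B(1)] by auto
  qed
  have "4 \<le> card (off v w c)" using card_off m(1) by blast
  moreover have "card (off v w c - {insert x T, insert y T}) \<ge> card (off v w c) - card {insert x T, insert y T}"
    by (rule diff_card_le_card_Diff) simp
  moreover have "card {insert x T, insert y T} \<le> 2" by (rule card_pair_le)
  ultimately have "2 \<le> card (off v w c - {insert x T, insert y T})" by linarith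
  note two = this
  have X: "insert x T \<in> up t t' x" "insert y T \<in> up t t' y" using Tx Ty T by (auto simp: up_def)
  have in_up: "(B \<in> up t t' x \<longleftrightarrow> x \<in> B) \<and> (B \<in> up t t' y \<longleftrightarrow> y \<in> B) \<and> (x \<in> B \<or> y \<in> B)"
    if "B \<in> off v w c - {insert x T, insert y T}" for B
    using N[of B] that by (auto simp: up_def off_def)
  have sep: "x \<in> B \<or> y \<in> B" if "B \<in> off v w c - {insert x T, insert y T}" for B
    using in_up[OF that] by simp
  \<comment> \<open>The triple \<open>t\<close>, \<open>t'\<close>, \<open>x\<close> has at most two
    extensions, and \<open>insert x T\<close> is one of them.\<close>
  have same_x: "B = B'" if "B \<in> off v w c - {insert x T, insert y T}"
    "B' \<in> off v w c - {insert x T, insert y T}" "x \<in> B" "x \<in> B'" for B B'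
    using up_three[OF _ _ X(1) D(1), of B B'] in_up that by auto
  have same_y: "B = B'" if "B \<in> off v w c - {insert x T, insert y T}"
    "B' \<in> off v w c - {insert x T, insert y T}" "y \<in> B" "y \<in> B'" for B B'
    using up_three[OF _ _ X(2) D(2), of B B'] in_up that by auto
  obtain X Y where XY: "X \<in> off v w c - {insert x T, insert y T}" "x \<in> X" "y \<notin> X"
      "Y \<in> off v w c - {insert x T, insert y T}" "y \<in> Y" "x \<notin> Y"
    by (rule obtain_separated[OF two sep same_x same_y])
  have "X \<in> up t t' x" "Y \<in> up t t' y" using in_up XY by auto
  obtain z where z: "X = {t, t', x, z}" using up_eq[OF \<open>X \<in> up t t' x\<close> D(1)] by blast
  obtain z' where z': "Y = {t, t', y, z'}" using up_eq[OF \<open>Y \<in> up t t' y\<close> D(2)] by blast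
  have mz: "{t, t', x, z} \<in> \<A>" "{t, t', y, z'} \<in> \<A>" using XY z z' by (auto simp: off_def)
  have "z \<noteq> t''"
  proof
    assume "z = t''"
    then have "X = insert x T" using z T by auto
    then show False using XY by auto
  qed
  moreover have "z' \<noteq> t''"
  proof
    assume "z' = t''"
    then have "Y = insert y T" using z' T by auto
    then show False using XY by auto
  qed
  ultimately have "z \<notin> {y, t'', v, w, c}" "z' \<notin> {x, t'', v, w, c}"
    using XY z z' by (auto simp: off_def)
  then have zz: "z = u \<or> z = d" "z' = u \<or> z' = d"
    using fourth_vertex[OF T m mz(1)] sw.fourth_vertex[OF T m mz(2)] by auto
  have dd: "\<not> (z = d \<and> z' = d)" using not_both_end[OF T m(1)] mz by auto
  have vwd: "{v, w, d, t} \<in> \<A> \<and> {v, w, d, t'} \<in> \<A>"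
  proof -
    obtain s s' where s: "s \<in> T" "s' \<in> T" "s \<noteq> s'" "{v, w, d, s} \<in> \<A>" "{v, w, d, s'} \<in> \<A>"
      using twices(2) by (auto simp: twice_def)
    \<comment> \<open>One of \<open>z\<close>, \<open>z'\<close> is \<open>u\<close>, and the
      corresponding member is disjoint from \<open>{v, w, d, t''}\<close>.\<close>
    have "{v, w, d, t''} \<notin> \<A>"
    proof
      assume a: "{v, w, d, t''} \<in> \<A>"
      have "{t, t', x, u} \<in> \<A> \<or> {t, t', y, u} \<in> \<A>" using mz zz dd by auto
      then show False using hit[OF a] all_distinct path_T x_T y_T T by fastforce
    qed
    then have "s \<noteq> t''" "s' \<noteq> t''" using s by auto
    then have "s = t \<and> s' = t' \<or> s = t' \<and> s' = t" using s(1-3) T by auto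
    then show ?thesis using s by auto
  qed
  have uu: "\<not> (z = u \<and> z' = u)" using not_both_inner[OF T m(1)] mz vwd by auto
  consider "z = u" "z' = d" | "z = d" "z' = u" using zz dd uu by blast
  then have "{v, d, u, t''} \<in> \<A>"
    using third_point[OF T m(1)] sw.third_point[OF T m(1)] mz by cases auto
  then show ?thesis using T m vwd by blast
qed

lemma impossible: False
proof -
  interpret re: forked_path \<A> T x y d c v u w by (rule reflect)
  obtain t t' t'' where T: "T = {t, t', t''}" "distinct [t, t', t'']"
    and m: "{v, w, d, t} \<in> \<A>" "{v, w, d, t'} \<in> \<A>" "{v, d, u, t''} \<in> \<A>"
    using half by blast
  obtain r r' r'' where R: "T = {r, r', r''}" "distinct [r, r', r'']"
    and n: "{v, d, u, r} \<in> \<A>" "{v, d, u, r'} \<in> \<A>" "{v, d, w, r} \<in> \<A>" "{v, d, w, r'} \<in> \<A>"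
    using re.half by blast
  have m': "{v, d, w, t} \<in> \<A>" "{v, d, w, t'} \<in> \<A>" using m by (auto simp: insert_commute)
  \<comment> \<open>The triple \<open>v\<close>, \<open>d\<close>, \<open>w\<close> has only two
    extensions, so the two pairs coincide; then \<open>v\<close>, \<open>d\<close>, \<open>u\<close>
    has the three extensions \<open>r\<close>, \<open>r'\<close>, \<open>t''\<close>.\<close>
  have "r = t \<or> r = t'" "r' = t \<or> r' = t'"
    using no_three_extensions[OF m' n(3)] no_three_extensions[OF m' n(4)] T by auto
  then have "distinct [r, r', t'']" using R T by auto
  then show False using no_three_extensions[OF n(1,2) m(3)] by auto
qed

end

section \<open>From four edges to a 4-cycle\<close>

context forked_triple begin

text \<open>A disjoint edge \<open>c d\<close> would force a member \<open>{u, c, d, s}\<close> with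
  \<open>s\<close> in \<open>T\<close>, which every edge must meet outside \<open>T\<close>. A
  fourth edge then starts at \<open>c\<close> or \<open>d\<close>, and it either completes a
  forbidden path or forces too many members through \<open>v\<close>, \<open>w\<close> and that
  vertex.\<close>

lemma edge_touches:
  assumes uv: "{x, y, u, v} \<in> \<A>" and uw: "{x, y, u, w} \<in> \<A>" and vw: "v \<noteq> w"
    and T: "T \<inter> {u, v, w} = {}" and B: "B \<in> \<A>" "B \<inter> T = {}"
  shows "u \<in> B \<or> v \<in> B \<or> w \<in> B"
proof (rule ccontr)
  assume nB: "\<not> ?thesis"
  have xB: "x \<in> B" "y \<in> B" using off_T B by auto
  obtain c d where Bcd: "B = {x, y, c, d}" "distinct [x, y, c, d]" using pair_eq[OF B(1) xB xy] by blast
  have cd: "{x, y, c, d} \<in> \<A>" and dc: "{x, y, d, c} \<in> \<A>" using B Bcd by (auto simp: insert_commute)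
  have D: "distinct [x, y, u, v, w, c, d]"
    using distinct_member[OF uv] distinct_member[OF uw] vw nB Bcd by auto
  have T': "T \<inter> {u, v, w, c, d} = {}" using T B Bcd by auto
  have tw: "twice v w c T" "twice v w d T" using off_fork_twice[OF uv uw cd] D T' by auto
  obtain t where t: "t \<in> T" "{v, w, c, t} \<in> \<A>" "{v, w, d, t} \<in> \<A>"
    using twice_common[OF tw card_T] .
  \<comment> \<open>Members missing \<open>v\<close>, \<open>w\<close>, \<open>t\<close> contain
    \<open>c\<close> and \<open>d\<close>. Besides \<open>{x, y, c, d}\<close>, at most one contains
    \<open>x\<close> and at most one contains \<open>y\<close>, so heaviness leaves one that misses
    both.\<close>
  have "\<not> off v w t \<subseteq> {{x, y, c, d}} \<union> ((up c d x - {{x, y, c, d}}) \<union> (up c d y - {{x, y, c, d}}))"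
  proof
    let ?B = "{x, y, c, d}"
    assume "off v w t \<subseteq> {?B} \<union> ((up c d x - {?B}) \<union> (up c d y - {?B}))"
    moreover have "{v, w, t, c} \<in> \<A>" using t(2) by (simp add: insert_commute)
    ultimately have "4 \<le> card ({?B} \<union> ((up c d x - {?B}) \<union> (up c d y - {?B})))"
      by (intro off_cover) auto
    also have "\<dots> \<le> card {?B} + (card (up c d x - {?B}) + card (up c d y - {?B}))"
      by (intro order_trans[OF card_Un_le] add_mono card_Un_le order_refl)
    also have "card (up c d x - {?B}) = card (up c d x) - 1"
      using cd by (intro card_Diff_singleton) (auto simp: up_def)
    also have "card (up c d y - {?B}) = card (up c d y) - 1"
      using cd by (intro card_Diff_singleton) (auto simp: up_def)
    finally show False using card_up[of c d x] card_up[of c d y] D by auto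
  qed
  then obtain C where "C \<in> off v w t" and C2: "C \<notin> up c d x" "C \<notin> up c d y" by auto
  then have C: "C \<in> \<A>" "v \<notin> C" "w \<notin> C" "t \<notin> C" by (auto simp: off_def)
  have Ccd: "c \<in> C" "d \<in> C" using hit[OF t(2) C(1)] hit[OF t(3) C(1)] C by auto
  then have Cxy: "x \<notin> C" "y \<notin> C" using C2 C by (auto simp: up_def)
  then have Cu: "u \<in> C" using hit[OF uv C(1)] C by auto
  obtain s where s: "s \<in> T" "s \<in> C" using hit_T C Cxy by blast
  have "C = {u, c, d, s}" using member_eq[OF C(1) Cu Ccd s(2)] s(1) T' D by auto
  then have touch: "u \<in> E \<or> c \<in> E \<or> d \<in> E" if "E \<in> \<A>" "E \<inter> T = {}" for E
    using hit[of u c d s E] C that s by auto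
  obtain p q r where pqr: "T = {p, q, r}" using card_T by (auto simp: card_3_iff)
  have "{p, q, r, x} \<in> \<A>" using Tx pqr by (simp add: insert_commute)
  then obtain E where "E \<in> off p q r" "E \<noteq> {x, y, u, v}" "E \<noteq> {x, y, u, w}" "E \<noteq> {x, y, c, d}"
    by (rule off_new)
  then have E: "E \<in> \<A>" "E \<inter> T = {}" and new: "E \<notin> {{x, y, u, v}, {x, y, u, w}, {x, y, c, d}}"
    using pqr by (auto simp: off_def)
  have xE: "x \<in> E" "y \<in> E" using off_T E by auto
  have uE: "u \<notin> E"
  proof
    assume "u \<in> E"
    then have "v \<in> E \<or> w \<in> E" using up_two[OF uv uw vw E(1) xE] by blast
    then have "E = {x, y, u, v} \<or> E = {x, y, u, w}"
      using member_eq[OF E(1) xE \<open>u \<in> E\<close>] D by auto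
    then show False using new by blast
  qed
  have not_cd: "\<not> (c \<in> E \<and> d \<in> E)"
  proof
    assume "c \<in> E \<and> d \<in> E"
    then have "E = {x, y, c, d}" using member_eq[OF E(1) xE] D by auto
    then show False using new by blast
  qed
  have main: False if c: "c \<in> E" and d: "d \<notin> E" and cd: "{x, y, c, d} \<in> \<A>"
    and D: "distinct [x, y, u, v, w, c, d]" and T': "T \<inter> {u, v, w, c, d} = {}" for c d
  proof -
    have "x \<noteq> c" using D by auto
    have "E \<in> up x y c" using E xE c by (auto simp: up_def)
    then obtain z where z: "E = {x, y, c, z}" "distinct [x, y, c, z]" using up_eq[of E x y c] D by auto
    have vz: "z \<notin> {u, d}" using uE d z by auto
    have zT: "z \<notin> T" using z E by auto
    have zE: "{x, y, c, z} \<in> \<A>" "{x, y, z, c} \<in> \<A>" using z E by (auto simp: insert_commute)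
    have wu: "{x, y, w, u} \<in> \<A>" "{x, y, v, u} \<in> \<A>" using uv uw by (auto simp: insert_commute)
    have "z \<noteq> v"
    proof
      assume "z = v"
      then interpret forked_path \<A> T x y w u v c d
        using wu uv zE cd D T' by unfold_locales auto
      show False by (rule impossible)
    qed
    moreover have "z \<noteq> w"
    proof
      assume "z = w"
      then interpret forked_path \<A> T x y v u w c d
        using wu uw zE cd D T' by unfold_locales auto
      show False by (rule impossible)
    qed
    ultimately have D': "distinct [v, w, c, d, z]" using vz z D by auto
    have "off x y u \<subseteq> up v w c"
    proof
      fix B assume B: "B \<in> off x y u"
      have B': "B \<in> \<A>" "x \<notin> B" using B by (auto simp: off_def)
      note o = off_fork[OF uv uw cd B] off_fork[OF uv uw zE(1) B]
      obtain t where t: "t \<in> T" "t \<in> B" using hit_T B' by blast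
      \<comment> \<open>Missing \<open>c\<close> would put \<open>d\<close> and \<open>z\<close>
        into \<open>B\<close> together with \<open>v\<close>, \<open>w\<close> and \<open>t\<close>:
        five points.\<close>
      have "c \<in> B"
        using no_five[OF B'(1) o(1,2) _ _ t(2), of d z] o(3,6) t(1) D' T' zT by auto
      then show "B \<in> up v w c" using o B' by (auto simp: up_def)
    qed
    then have "4 \<le> card (up v w c)" using off_cover uv by auto
    then show False using card_up[of v w c] D' by auto
  qed
  show False
    using touch[OF E] uE not_cd main[OF _ _ cd D T'] main[OF _ _ dc] D T' by auto
qed

text \<open>Otherwise there are four pairwise disjoint edges, and a member missing \<open>x\<close>
  and \<open>y\<close> needs a point in each of them and one more in \<open>T\<close>.\<close>

lemma two_neighbours:
  obtains u v w where "{x, y, u, v} \<in> \<A>" "{x, y, u, w} \<in> \<A>" "v \<noteq> w" "T \<inter> {u, v, w} = {}"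
proof -
  obtain p q r where pqr: "T = {p, q, r}" using card_T by (auto simp: card_3_iff)
  have "{p, q, r, x} \<in> \<A>" using Tx pqr by (simp add: insert_commute)
  then have "4 \<le> card (off p q r)" by (rule card_off)
  then obtain B1 B2 B3 B4 where "B1 \<in> off p q r" "B2 \<in> off p q r" "B3 \<in> off p q r" "B4 \<in> off p q r"
    and ne: "distinct [B1, B2, B3, B4]" by (rule card_ge_4_obtain)
  then have B: "B1 \<in> \<A>" "B2 \<in> \<A>" "B3 \<in> \<A>" "B4 \<in> \<A>"
      "B1 \<inter> T = {}" "B2 \<inter> T = {}" "B3 \<inter> T = {}" "B4 \<inter> T = {}"
    using pqr by (auto simp: off_def)
  show ?thesis
  proof (rule ccontr)
    assume neg: "\<not> thesis"
    note found = that
    have disj: "z \<notin> B'" if B': "B \<in> \<A>" "B' \<in> \<A>" "B \<inter> T = {}" "B' \<inter> T = {}" "B \<noteq> B'"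
      and z: "z \<in> B" "z \<noteq> x" "z \<noteq> y" for B B' z
    proof
      assume "z \<in> B'"
      then have "B \<in> up x y z" "B' \<in> up x y z" "distinct [x, y, z]"
        using B' z xy off_T by (auto simp: up_def)
      then obtain v w where "B = {x, y, z, v}" "B' = {x, y, z, w}" by (meson up_eq)
      then show False using found[of z v w] neg B' by auto
    qed
    obtain u u' where u: "B1 = {x, y, u, u'}" "distinct [x, y, u, u']"
      using pair_eq[OF B(1) _ _ xy] off_T B by metis
    have "off x y u \<noteq> {}" using card_off[of x y u u'] u B by force
    then obtain C where C: "C \<in> \<A>" "x \<notin> C" "y \<notin> C" by (auto simp: off_def)
    obtain z1 z2 z3 z4 where z: "z1 \<in> C \<inter> B1" "z2 \<in> C \<inter> B2" "z3 \<in> C \<inter> B3" "z4 \<in> C \<inter> B4"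
      using meet[OF C(1) B(1)] meet[OF C(1) B(2)] meet[OF C(1) B(3)] meet[OF C(1) B(4)] by auto
    then have zC: "z1 \<in> C" "z2 \<in> C" "z3 \<in> C" "z4 \<in> C" by auto
    have dz: "z \<noteq> z'" if "B \<in> \<A>" "B' \<in> \<A>" "B \<inter> T = {}" "B' \<inter> T = {}" "B \<noteq> B'"
      "z \<in> C \<inter> B" "z' \<in> C \<inter> B'" for B B' z z'
      using disj[OF that(1-5), of z] that(6,7) C by blast
    have "distinct [z1, z2, z3, z4]"
      using dz[OF B(1,2,5,6) _ z(1,2)] dz[OF B(1,3,5,7) _ z(1,3)] dz[OF B(1,4,5,8) _ z(1,4)]
        dz[OF B(2,3,6,7) _ z(2,3)] dz[OF B(2,4,6,8) _ z(2,4)] dz[OF B(3,4,7,8) _ z(3,4)] ne by simp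
    moreover obtain t where t: "t \<in> T" "t \<in> C" using hit_T C by blast
    moreover have zB: "t \<noteq> z1" "t \<noteq> z2" "t \<noteq> z3" "t \<noteq> z4"  using t z B(5-8) by auto
    ultimately show False using no_five[OF C(1) zC, of t] zB by auto
  qed
qed

text \<open>\<open>u\<close> has no third edge, and every other edge passes through \<open>v\<close>
  or \<open>w\<close> by \<open>edge_touches\<close>. The degree bound allows one more edge at each
  of them, and \<open>edge_touches\<close> centred at \<open>v\<close> makes both end in the same
  vertex \<open>z\<close>.\<close>

lemma four_cycle:
  obtains a b c d where "{x, y, a, b} \<in> \<A>" "{x, y, b, c} \<in> \<A>" "{x, y, c, d} \<in> \<A>" "{x, y, d, a} \<in> \<A>"
    "distinct [x, y, a, b, c, d]" "T \<inter> {a, b, c, d} = {}"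
    "\<And>B. B \<in> \<A> \<Longrightarrow> B \<inter> T = {} \<Longrightarrow> B \<in> {{x, y, a, b}, {x, y, b, c}, {x, y, c, d}, {x, y, d, a}}"
proof -
  obtain u v w where uv: "{x, y, u, v} \<in> \<A>" and uw: "{x, y, u, w} \<in> \<A>" and vw: "v \<noteq> w"
    and T: "T \<inter> {u, v, w} = {}" by (rule two_neighbours)
  have vu: "{x, y, v, u} \<in> \<A>" and wu: "{x, y, w, u} \<in> \<A>" using uv uw by (auto simp: insert_commute)
  have D: "distinct [x, y, u, v, w]" using distinct_member[OF uv] distinct_member[OF uw] vw by auto
  let ?N = "{B \<in> \<A>. B \<inter> T = {}} - {{x, y, u, v}, {x, y, u, w}}"
  obtain p q r where pqr: "T = {p, q, r}" using card_T by (auto simp: card_3_iff)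
  have "{p, q, r, x} \<in> \<A>" using Tx pqr by (simp add: insert_commute)
  then have "4 \<le> card (off p q r)" by (rule card_off)
  moreover have "off p q r = {B \<in> \<A>. B \<inter> T = {}}" using pqr by (auto simp: off_def)
  moreover have "card {B \<in> \<A>. B \<inter> T = {}} - card {{x, y, u, v}, {x, y, u, w}} \<le> card ?N"
    by (rule diff_card_le_card_Diff) simp
  moreover have "card {{x, y, u, v}, {x, y, u, w}} \<le> 2" by (rule card_pair_le)
  ultimately have N2: "2 \<le> card ?N" by simp
  have N: "B \<in> \<A> \<and> B \<inter> T = {} \<and> x \<in> B \<and> y \<in> B \<and> u \<notin> B \<and> (v \<in> B \<or> w \<in> B)" if B: "B \<in> ?N" for B
  proof -
    have B1: "B \<in> \<A>" "B \<inter> T = {}" "x \<in> B" "y \<in> B" using off_T B by auto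
    have "u \<notin> B"
    proof
      assume u: "u \<in> B"
      then have "v \<in> B \<or> w \<in> B" using up_two[OF uv uw vw B1(1,3,4)] by blast
      then have "B = {x, y, u, v} \<or> B = {x, y, u, w}"
        using member_eq[OF B1(1,3,4) u] D by auto
      then show False using B by blast
    qed
    then show ?thesis using edge_touches[OF uv uw vw T B1(1,2)] B1 by blast
  qed
  have vw_N: "v \<in> B \<or> w \<in> B" if "B \<in> ?N" for B using N[OF that] by simp
  have vN: "B = B'" if "B \<in> ?N" "B' \<in> ?N" "v \<in> B" "v \<in> B'" for B B'
    using up_three[of B x y v B' "{x, y, v, u}"] N[OF that(1)] N[OF that(2)] that vu D by (auto simp: up_def)
  have wN: "B = B'" if "B \<in> ?N" "B' \<in> ?N" "w \<in> B" "w \<in> B'" for B B'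
    using up_three[of B x y w B' "{x, y, w, u}"] N[OF that(1)] N[OF that(2)] that wu D by (auto simp: up_def)
  obtain P Q where P: "P \<in> ?N" "v \<in> P" "w \<notin> P" and Q: "Q \<in> ?N" "w \<in> Q" "v \<notin> Q"
    by (rule obtain_separated[OF N2 vw_N vN wN])
  obtain z where z: "P = {x, y, v, z}" "distinct [x, y, v, z]"
    using up_eq[of P x y v] N[OF P(1)] P D by (auto simp: up_def)
  obtain z' where z': "Q = {x, y, w, z'}" "distinct [x, y, w, z']"
    using up_eq[of Q x y w] N[OF Q(1)] Q D by (auto simp: up_def)
  have vz: "{x, y, v, z} \<in> \<A>" and zu: "z \<noteq> u" "z \<notin> T" using N[OF P(1)] z by auto
  have "v \<in> Q \<or> u \<in> Q \<or> z \<in> Q"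
    using edge_touches[OF vu vz _ _, of Q] zu T N[OF Q(1)] by auto
  then have "z \<in> Q" using N[OF Q(1)] Q(3) by blast
  then have "z \<in> {x, y, w, z'}" using z'(1) by blast
  moreover have "z \<noteq> w" using z(1) P(3) by blast
  ultimately have zz: "z = z'" using z(2) by auto
  have Qz: "Q = {x, y, z, w}" unfolding z'(1) zz by (simp add: insert_commute)
  then have zw: "{x, y, z, w} \<in> \<A>" using N[OF Q(1)] by simp
  have "distinct [x, y, u, v, z, w]" using D z(2) z'(2) zz zu(1) by simp
  moreover have "B \<in> {{x, y, u, v}, {x, y, v, z}, {x, y, z, w}, {x, y, w, u}}"
    if B: "B \<in> \<A>" "B \<inter> T = {}" for B
  proof (cases "B \<in> ?N")
    case True
    then have "B = P \<or> B = Q" using vw_N[OF True] vN[OF True P(1) _ P(2)] wN[OF True Q(1) _ Q(2)] by argo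
    then show ?thesis using z(1) Qz by blast
  next
    case False
    moreover have "{x, y, u, w} = {x, y, w, u}" by (simp add: insert_commute)
    ultimately show ?thesis using B by blast
  qed
  moreover have "T \<inter> {u, v, z, w} = {}" using T zu(2) by simp
  ultimately show ?thesis using that[OF uv vz zw wu] by blast
qed

text \<open>Every vertex of a 4-cycle lies on two edges. In this form the cycles over
  \<open>{x, y, a}\<close> and \<open>{x, y, c}\<close> are compared below.\<close>

lemma second_member:
  assumes B: "B \<in> \<A>" "B \<inter> T = {}" "p \<in> B" "p \<notin> {x, y}"
  obtains B' where "B' \<in> \<A>" "B' \<inter> T = {}" "p \<in> B'" "B' \<noteq> B"
proof -
  obtain a b c d where C: "{x, y, a, b} \<in> \<A>" "{x, y, b, c} \<in> \<A>" "{x, y, c, d} \<in> \<A>" "{x, y, d, a} \<in> \<A>"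
    and D: "distinct [x, y, a, b, c, d]" "T \<inter> {a, b, c, d} = {}"
    and all: "\<And>B. B \<in> \<A> \<Longrightarrow> B \<inter> T = {} \<Longrightarrow> B \<in> {{x, y, a, b}, {x, y, b, c}, {x, y, c, d}, {x, y, d, a}}"
    by (rule four_cycle) blast
  note found = that
  have p: "p \<in> {a, b, c, d}" using all[OF B(1,2)] B(3,4) by auto
  have two: thesis if M: "M \<in> \<A>" "M' \<in> \<A>" "p \<in> M" "p \<in> M'" "M \<inter> T = {}" "M' \<inter> T = {}"
      "q \<in> M" "q \<notin> M'" for M M' q
    using found[of M] found[of M'] M by (cases "B = M") auto
  have disj: "{x, y, a, b} \<inter> T = {}" "{x, y, b, c} \<inter> T = {}" "{x, y, c, d} \<inter> T = {}"
    "{x, y, d, a} \<inter> T = {}"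
    using x_T y_T D(2) by auto
  from p consider "p = a" | "p = b" | "p = c" | "p = d" by blast
  then show ?thesis
  proof cases
    case 1 show ?thesis by (rule two[OF C(1,4) _ _ disj(1,4), of b]) (use 1 D(1) in auto)
  next
    case 2 show ?thesis by (rule two[OF C(1,2) _ _ disj(1,2), of a]) (use 2 D(1) in auto)
  next
    case 3 show ?thesis by (rule two[OF C(2,3) _ _ disj(2,3), of b]) (use 3 D(1) in auto)
  next
    case 4 show ?thesis by (rule two[OF C(3,4) _ _ disj(3,4), of c]) (use 4 D(1) in auto)
  qed
qed

end

section \<open>Excluding the 4-cycle\<close>

context forked_triple begin

text \<open>Both \<open>{x, y, a}\<close> and \<open>{x, y, c}\<close> extend by \<open>b\<close>
  and by \<open>d\<close>, so each carries its own 4-cycle. If \<open>B = {b, d, c, p}\<close>,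
  moving to a second member through \<open>p\<close> in one cycle and then in the other yields three
  members through \<open>b\<close>, \<open>d\<close>, \<open>p\<close>.\<close>

lemma opposite_vertex:
  assumes ab: "{x, y, a, b} \<in> \<A>" and bc: "{x, y, b, c} \<in> \<A>" and cd: "{x, y, c, d} \<in> \<A>"
    and da: "{x, y, d, a} \<in> \<A>" and D: "distinct [x, y, a, b, c, d]"
    and B: "B \<in> \<A>" "B \<inter> {x, y, a} = {}"
  shows "c \<notin> B"
proof
  assume c: "c \<in> B"
  interpret Q: forked_triple \<A> "{x, y, a}" b d
    using ab da D by unfold_locales (auto simp: insert_commute)
  interpret R: forked_triple \<A> "{x, y, c}" b d
    using bc cd D by unfold_locales (auto simp: insert_commute)
  have bd: "b \<in> B" "d \<in> B" using Q.off_T B by auto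
  then have "B \<in> up b d c" using c B by (auto simp: up_def)
  then obtain p where p: "B = {b, d, c, p}" "distinct [b, d, c, p]" using up_eq[of B b d c] D by auto
  obtain B' where B': "B' \<in> \<A>" "B' \<inter> {x, y, a} = {}" "p \<in> B'" "B' \<noteq> B"
    using Q.second_member[OF B, of p] p by auto
  have bd': "b \<in> B'" "d \<in> B'" using Q.off_T B' by auto
  have "c \<notin> B'"
    using member_eq[OF B'(1) bd' _ B'(3), of c] p B'(4) by auto
  then have "B' \<inter> {x, y, c} = {}" using B'(2) by auto
  then obtain B'' where B'': "B'' \<in> \<A>" "B'' \<inter> {x, y, c} = {}" "p \<in> B''" "B'' \<noteq> B'"
    using R.second_member[OF B'(1) _ B'(3)] p(2) by auto
  have "b \<in> B''" "d \<in> B''" using R.off_T B'' by auto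
  then have "B \<in> up b d p" "B' \<in> up b d p" "B'' \<in> up b d p"
    using B B' B'' bd bd' p(1) by (auto simp: up_def)
  then show False using up_three[of B b d p B' B''] p(2) B'(4) B''(2,4) c by auto
qed

lemma impossible: False
proof -
  obtain a b c d where C: "{x, y, a, b} \<in> \<A>" "{x, y, b, c} \<in> \<A>" "{x, y, c, d} \<in> \<A>" "{x, y, d, a} \<in> \<A>"
    and D: "distinct [x, y, a, b, c, d]"
    by (rule four_cycle) blast
  interpret Q: forked_triple \<A> "{x, y, a}" b d
    using C D by unfold_locales (auto simp: insert_commute)
  interpret R: forked_triple \<A> "{x, y, b}" a c
    using C D by unfold_locales (auto simp: insert_commute)
  obtain p q r s where P: "{b, d, p, q} \<in> \<A>" "{b, d, q, r} \<in> \<A>" "{b, d, r, s} \<in> \<A>" "{b, d, s, p} \<in> \<A>"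
    and E: "distinct [b, d, p, q, r, s]" "{x, y, a} \<inter> {p, q, r, s} = {}"
    by (rule Q.four_cycle) blast
  have "{b, d, p, q} \<inter> {x, y, a} = {}" "{b, d, r, s} \<inter> {x, y, a} = {}" using E(2) D by auto
  then have c: "c \<notin> {b, d, p, q}" "c \<notin> {b, d, r, s}"
    using opposite_vertex[OF C D] P(1,3) by blast+
  \<comment> \<open>A member missing \<open>x\<close>, \<open>y\<close>, \<open>b\<close> contains
    \<open>a\<close> and \<open>c\<close> but not \<open>d\<close>. Its two other points must cover
    the four edges of the cycle \<open>p q r s\<close>, so they are opposite vertices.\<close>
  have "off x y b \<subseteq> {{a, c, p, r}, {a, c, q, s}}"
  proof
    fix H assume "H \<in> off x y b"
    then have H: "H \<in> \<A>" "H \<inter> {x, y, b} = {}" by (auto simp: off_def)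
    have ac: "a \<in> H" "c \<in> H" using R.off_T H by auto
    have "d \<notin> H" by (rule opposite_vertex[OF C(2,3,4,1) _ H]) (use D in auto)
    then have "p \<in> H \<or> q \<in> H" "q \<in> H \<or> r \<in> H" "r \<in> H \<or> s \<in> H" "s \<in> H \<or> p \<in> H"
      using hit[OF P(1) H(1)] hit[OF P(2) H(1)] hit[OF P(3) H(1)] hit[OF P(4) H(1)] H(2) by auto
    then consider "p \<in> H" "r \<in> H" | "q \<in> H" "s \<in> H" by argo
    then show "H \<in> {{a, c, p, r}, {a, c, q, s}}"
    proof cases
      case 1
      then have "H = {a, c, p, r}" using member_eq[OF H(1) ac] D E c by auto
      then show ?thesis by blast
    next
      case 2
      then have "H = {a, c, q, s}" using member_eq[OF H(1) ac] D E c by auto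
      then show ?thesis by blast
    qed
  qed
  moreover have "{x, y, b, a} \<in> \<A>" using C(1) by (simp add: insert_commute)
  ultimately have "4 \<le> card {{a, c, p, r}, {a, c, q, s}}" by (intro off_cover) auto
  then show False using card_pair_le[of "{a, c, p, r}" "{a, c, q, s}"] by linarith
qed

end

section \<open>Common points of two members\<close>

context heavy_family begin

text \<open>A second member through \<open>a\<close>, \<open>b\<close>, \<open>c\<close> would make
  this triple a \<open>forked_triple\<close>.\<close>

lemma linear:
  assumes A: "A \<in> \<A>" "a \<in> A" "b \<in> A" "c \<in> A" and B: "B \<in> \<A>" "a \<in> B" "b \<in> B" "c \<in> B"
    and D: "distinct [a, b, c]"
  shows "A = B"
proof (rule ccontr)
  assume ne: "A \<noteq> B"
  have "A \<in> up a b c" "B \<in> up a b c" using A B by (auto simp: up_def)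
  then obtain p q where p: "A = {a, b, c, p}" and q: "B = {a, b, c, q}" using D up_eq by metis
  interpret forked_triple \<A> "{a, b, c}" p q
    using A B p q ne D by unfold_locales (auto simp: insert_commute)
  show False by (rule impossible)
qed

lemma card_up_le_1: "distinct [a, b, c] \<Longrightarrow> card (up a b c) \<le> 1"
proof -
  assume D: "distinct [a, b, c]"
  have "\<forall>A\<in>up a b c. \<forall>B\<in>up a b c. A = B" using linear[OF _ _ _ _ _ _ _ _ D] by (simp add: up_def)
  then show ?thesis using card_le_Suc0_iff_eq[OF finite_up[of a b c]] by simp
qed

text \<open>
  Members avoiding \<open>u\<close> and \<open>v\<close> choose a letter from each of the pairs \<open>{p, p'}\<close>, \<open>{q, q'}\<close>, \<open>{r, r'}\<close>;
  heaviness of \<open>{u, v, p'}\<close> forces every one of the eight words to occur.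
\<close>
lemma word:
  assumes m: "{u, v, p, p'} \<in> \<A>" "{u, v, q, q'} \<in> \<A>" "{u, v, r, r'} \<in> \<A>"
    and D: "distinct [u, v, p, p', q, q', r, r']"
  obtains z where "{p, q, r, z} \<in> \<A>" "z \<notin> {u, v, p', q', r'}"
proof (rule ccontr)
  assume no: "\<not> thesis"
  note found = that
  have "off u v p' \<subseteq> up p q r' \<union> (up p q' r \<union> up p q' r')"
  proof
    fix B assume "B \<in> off u v p'"
    then have B: "B \<in> \<A>" "u \<notin> B" "v \<notin> B" "p' \<notin> B" by (auto simp: off_def)
    then have h: "p \<in> B" "q \<in> B \<or> q' \<in> B" "r \<in> B \<or> r' \<in> B"
      using hit[OF m(1) B(1)] hit[OF m(2) B(1)] hit[OF m(3) B(1)] by auto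
    show "B \<in> up p q r' \<union> (up p q' r \<union> up p q' r')"
    proof (rule ccontr)
      assume "\<not> ?thesis"
      then have qr: "q \<in> B" "r \<in> B" "q' \<notin> B" "r' \<notin> B" using B(1) h by (auto simp: up_def)
      then have "B \<in> up p q r" using B h by (auto simp: up_def)
      then obtain z where z: "B = {p, q, r, z}" using up_eq[of B p q r] D by auto
      then show False using found[of z] no B qr by auto
    qed
  qed
  moreover have "{u, v, p', p} \<in> \<A>" using m(1) by (simp add: insert_commute)
  ultimately have "4 \<le> card (up p q r' \<union> (up p q' r \<union> up p q' r'))" by (intro off_cover) auto
  also have "\<dots> \<le> card (up p q r') + (card (up p q' r) + card (up p q' r'))"
    by (intro order_trans[OF card_Un_le] add_mono card_Un_le order_refl)
  also have "\<dots> \<le> 1 + (1 + 1)" using D by (intro add_mono card_up_le_1) auto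
  finally show False by simp
qed

text \<open>Each word is completed to a member by a fourth point. Complementary words share that
  point and neighbouring words do not, so \<open>z\<close>, \<open>z1\<close>, \<open>z2\<close>,
  \<open>z3\<close> are distinct; then only \<open>{p', q', r', z}\<close> can miss
  \<open>p\<close>, \<open>q\<close>, \<open>r\<close>.\<close>

lemma no_three_edges:
  assumes m: "{u, v, p, p'} \<in> \<A>" "{u, v, q, q'} \<in> \<A>" "{u, v, r, r'} \<in> \<A>"
    and D: "distinct [u, v, p, p', q, q', r, r']"
  shows False
proof -
  have m': "{u, v, p', p} \<in> \<A>" "{u, v, q', q} \<in> \<A>" "{u, v, r', r} \<in> \<A>"
    using m by (auto simp: insert_commute)
  obtain z where z: "{p, q, r, z} \<in> \<A>" "z \<notin> {u, v, p', q', r'}"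
    using word[OF m D] .
  obtain z1 where z1: "{p', q, r, z1} \<in> \<A>" "z1 \<notin> {u, v, p, q', r'}"
    by (rule word[OF m'(1) m(2,3)]) (use D in auto)
  obtain z2 where z2: "{p, q', r, z2} \<in> \<A>" "z2 \<notin> {u, v, p', q, r'}"
    by (rule word[OF m(1) m'(2) m(3)]) (use D in auto)
  obtain z3 where z3: "{p, q, r', z3} \<in> \<A>" "z3 \<notin> {u, v, p', q', r}"
    by (rule word[OF m(1,2) m'(3)]) (use D in auto)
  obtain y1 where y1: "{p, q', r', y1} \<in> \<A>" "y1 \<notin> {u, v, p', q, r}"
    by (rule word[OF m(1) m'(2,3)]) (use D in auto)
  obtain y2 where y2: "{p', q, r', y2} \<in> \<A>" "y2 \<notin> {u, v, p, q', r}"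
    by (rule word[OF m'(1) m(2) m'(3)]) (use D in auto)
  note d0 = distinct_member[OF z(1)] and d1 = distinct_member[OF z1(1)]
    and d2 = distinct_member[OF z2(1)] and d3 = distinct_member[OF z3(1)]
    and e1 = distinct_member[OF y1(1)] and e2 = distinct_member[OF y2(1)]
  \<comment> \<open>The words \<open>p' q r\<close> and \<open>p q' r'\<close> have no letter in
    common, so their members can meet only in the added point.\<close>
  have "z1 = y1" using hit[OF z1(1) y1(1)] z1(2) y1(2) d1 e1 D by auto
  have "z2 = y2" using hit[OF z2(1) y2(1)] z2(2) y2(2) d2 e2 D by auto
  have ne: "s \<noteq> s'" if "{a, b, c, s} \<in> \<A>" "{a', b, c, s'} \<in> \<A>" "a' \<notin> {a, b, c, s}" for a a' b c s s'
  proof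
    assume "s = s'"
    then have "{a, b, c, s} = {a', b, c, s'}"
      using that distinct_member[OF that(1)] by (intro linear[of _ b c s]) auto
    then show False using that(3) by auto
  qed
  have "z \<noteq> z1" by (rule ne[OF z(1) z1(1)]) (use D z in auto)
  moreover have "{q, p, r, z} \<in> \<A>" "{q', p, r, z2} \<in> \<A>" "{r, p, q, z} \<in> \<A>" "{r', p, q, z3} \<in> \<A>"
    using z z2 z3 by (auto simp: insert_commute)
  note zs = this
  moreover have "z \<noteq> z2" by (rule ne[OF zs(1,2)]) (use D z in auto)
  moreover have "z \<noteq> z3" by (rule ne[OF zs(3,4)]) (use D z in auto)
  \<comment> \<open>The words of \<open>z1\<close> and \<open>z2\<close> differ in two letters.
    Replacing the first by its complement leaves one difference, where \<open>ne\<close>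
    applies.\<close>
  moreover have "z1 \<noteq> z2"
  proof -
    have "{r, p, q', z2} \<in> \<A>" "{r', p, q', y1} \<in> \<A>" using z2 y1 by (auto simp: insert_commute)
    then have "z2 \<noteq> y1" by (rule ne) (use D z2 d2 in auto)
    then show ?thesis using \<open>z1 = y1\<close> by simp
  qed
  moreover have "z1 \<noteq> z3"
  proof -
    have "{q, p, r', z3} \<in> \<A>" "{q', p, r', y1} \<in> \<A>" using z3 y1 by (auto simp: insert_commute)
    then have "z3 \<noteq> y1" by (rule ne) (use D z3 in auto)
    then show ?thesis using \<open>z1 = y1\<close> by simp
  qed
  moreover have "z2 \<noteq> z3"
  proof -
    have "{p, q, r', z3} \<in> \<A>" "{p', q, r', y2} \<in> \<A>" using z3 y2 by auto
    then have "z3 \<noteq> y2" by (rule ne) (use D z3 in auto)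
    then show ?thesis using \<open>z2 = y2\<close> by simp
  qed
  ultimately have Z: "distinct [z, z1, z2, z3]" by auto
  have Z1: "z1 \<notin> {p', q', r'}" "z2 \<notin> {p', q', r'}" "z3 \<notin> {p', q', r'}"
    using z1(2) z2(2) z3(2) d1 d2 d3 y1(2) y2(2) e1 e2 \<open>z1 = y1\<close> \<open>z2 = y2\<close> by auto
  have "off p q r \<subseteq> {{p', q', r', z}}"
  proof
    fix B assume "B \<in> off p q r"
    then have B: "B \<in> \<A>" "p \<notin> B" "q \<notin> B" "r \<notin> B" by (auto simp: off_def)
    have zB: "z \<in> B" using hit[OF z(1) B(1)] B by auto
    have h: "p' \<in> B \<or> z1 \<in> B" "q' \<in> B \<or> z2 \<in> B" "r' \<in> B \<or> z3 \<in> B"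
      using hit[OF z1(1) B(1)] hit[OF z2(1) B(1)] hit[OF z3(1) B(1)] B by auto
    \<comment> \<open>\<open>B\<close> contains \<open>z\<close> and a point from each of
      \<open>{p', z1}\<close>, \<open>{q', z2}\<close>, \<open>{r', z3}\<close>; one of
      \<open>u\<close>, \<open>v\<close> would be the fifth point.\<close>
    have five: False if "k \<in> B" "k = u \<or> k = v" for k
    proof -
      obtain f g h where fgh: "f \<in> B" "f = p' \<or> f = z1" "g \<in> B" "g = q' \<or> g = z2" "h \<in> B" "h = r' \<or> h = z3"
        using h by metis
      have "distinct [f, g, h]" using fgh(2,4,6) D Z Z1 by auto
      moreover have "f \<noteq> z" "g \<noteq> z" "h \<noteq> z" using fgh(2,4,6) z(2) Z by auto
      moreover have "f \<noteq> k" "g \<noteq> k" "h \<noteq> k" using fgh(2,4,6) that(2) z1(2) z2(2) z3(2) D by auto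
      moreover have "z \<noteq> k" using that(2) z(2) by auto
      ultimately show False using no_five[OF B(1) that(1) zB fgh(1,3,5)] by auto
    qed
    then have "u \<notin> B" "v \<notin> B" by blast+
    then have "p' \<in> B" "q' \<in> B" "r' \<in> B"
      using hit[OF m(1) B(1)] hit[OF m(2) B(1)] hit[OF m(3) B(1)] B by auto
    then have "B = {p', q', r', z}" using member_eq[OF B(1) _ _ _ zB] D z(2) by auto
    then show "B \<in> {{p', q', r', z}}" by simp
  qed
  then have "4 \<le> card {{p', q', r', z}}" by (intro off_cover[OF z(1)]) auto
  then show False by simp
qed

lemma common_pair:
  assumes B: "B1 \<in> \<A>" "B2 \<in> \<A>" "B3 \<in> \<A>" and u: "u \<in> B1" "u \<in> B2" "u \<in> B3"
    and v: "v \<in> B1" "v \<in> B2" "v \<in> B3" and uv: "u \<noteq> v"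
  shows "B1 = B2 \<or> B1 = B3 \<or> B2 = B3"
proof (rule ccontr)
  assume ne: "\<not> ?thesis"
  obtain p p' where p: "B1 = {u, v, p, p'}" "distinct [u, v, p, p']" by (rule pair_eq[OF B(1) u(1) v(1) uv])
  obtain q q' where q: "B2 = {u, v, q, q'}" "distinct [u, v, q, q']" by (rule pair_eq[OF B(2) u(2) v(2) uv])
  obtain r r' where r: "B3 = {u, v, r, r'}" "distinct [u, v, r, r']" by (rule pair_eq[OF B(3) u(3) v(3) uv])
  have dj: "z \<notin> B'" if "B \<in> \<A>" "B' \<in> \<A>" "B \<noteq> B'" "u \<in> B" "u \<in> B'" "v \<in> B" "v \<in> B'"
    "z \<in> B" "z \<noteq> u" "z \<noteq> v" for B B' z
    using linear[of B u v z B'] that uv by auto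
  have "p \<notin> B2" "p' \<notin> B2" using dj[OF B(1,2) _ u(1,2) v(1,2)] ne p by auto
  moreover have "p \<notin> B3" "p' \<notin> B3" using dj[OF B(1,3) _ u(1,3) v(1,3)] ne p by auto
  moreover have "q \<notin> B3" "q' \<notin> B3" using dj[OF B(2,3) _ u(2,3) v(2,3)] ne q by auto
  ultimately have "distinct [u, v, p, p', q, q', r, r']" using p(2) q r by auto
  then show False using no_three_edges B p(1) q(1) r(1) by blast
qed

text \<open>The count behind \<open>word\<close>, for two pairs: of at least four members missing
  \<open>u\<close>, \<open>v\<close>, \<open>p'\<close>, at most two contain both \<open>p\<close>
  and \<open>q'\<close>, by \<open>common_pair\<close>.\<close>

lemma pair_word:
  assumes m: "{u, v, p, p'} \<in> \<A>" "{u, v, q, q'} \<in> \<A>" and D: "distinct [u, v, p, p', q, q']"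
  obtains B1 B2 where "B1 \<in> \<A>" "B2 \<in> \<A>" "B1 \<noteq> B2" "p \<in> B1" "q \<in> B1" "p \<in> B2" "q \<in> B2"
    "B1 \<inter> {u, v, p', q'} = {}" "B2 \<inter> {u, v, p', q'} = {}"
proof -
  let ?R = "{B \<in> off u v p'. q' \<in> B}" and ?P = "{B \<in> off u v p'. q' \<notin> B}"
  have h: "p \<in> B \<and> (q \<in> B \<or> q' \<in> B)" if "B \<in> off u v p'" for B
    using hit[OF m(1), of B] hit[OF m(2), of B] that by (auto simp: off_def)
  have "{u, v, p', p} \<in> \<A>" using m(1) by (simp add: insert_commute)
  then have "4 \<le> card (off u v p')" by (rule card_off)
  also have "off u v p' = ?R \<union> ?P" by blast
  also have "card (?R \<union> ?P) \<le> card ?R + card ?P" by (rule card_Un_le)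
  finally have "4 \<le> card ?R + card ?P" .
  moreover have "card ?R \<le> 2"
  proof (rule ccontr)
    assume "\<not> card ?R \<le> 2"
    then have "3 \<le> card ?R" by simp
    then obtain A B C where R: "A \<in> ?R" "B \<in> ?R" "C \<in> ?R" "A \<noteq> B" "A \<noteq> C" "B \<noteq> C"
      by (rule card_ge_3_obtain)
    then show False using common_pair[of A B C p q'] h D by (auto simp: off_def)
  qed
  ultimately have "2 \<le> card ?P" by linarith
  then obtain B1 B2 where B: "B1 \<in> ?P" "B2 \<in> ?P" "B1 \<noteq> B2" by (rule card_ge_2_obtain)
  then have "q \<in> B1" "q \<in> B2" "p \<in> B1" "p \<in> B2" using h[of B1] h[of B2] by auto
  then show ?thesis using that[of B1 B2] B by (auto simp: off_def)
qed

text \<open>\<open>pair_word\<close> gives \<open>F1\<close>, \<open>F2\<close> through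
  \<open>w\<close>, \<open>a\<close> and \<open>G1\<close>, \<open>G2\<close> through
  \<open>w'\<close>, \<open>b\<close>, whose four crossings are distinct. Applied again to
  \<open>F1\<close> and \<open>F2\<close> it gives two members through \<open>i\<close>,
  \<open>j\<close>; each must meet \<open>G2\<close> in \<open>w'\<close> or \<open>b\<close>, so it
  shares three points with \<open>G1\<close> and equals it.\<close>

lemma no_two_edges:
  assumes m: "{u, v, w, w'} \<in> \<A>" "{u, v, a, b} \<in> \<A>" and D: "distinct [u, v, w, w', a, b]"
  shows False
proof -
  have m': "{u, v, w', w} \<in> \<A>" "{u, v, b, a} \<in> \<A>" using m by (auto simp: insert_commute)
  obtain F1 F2 where F: "F1 \<in> \<A>" "F2 \<in> \<A>" "F1 \<noteq> F2" "w \<in> F1" "a \<in> F1" "w \<in> F2" "a \<in> F2"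
    "F1 \<inter> {u, v, w', b} = {}" "F2 \<inter> {u, v, w', b} = {}"
    by (rule pair_word[OF m D])
  obtain G1 G2 where G: "G1 \<in> \<A>" "G2 \<in> \<A>" "G1 \<noteq> G2" "w' \<in> G1" "b \<in> G1" "w' \<in> G2" "b \<in> G2"
    "G1 \<inter> {u, v, w, a} = {}" "G2 \<inter> {u, v, w, a} = {}"
    by (rule pair_word[OF m']) (use D in auto)
  have wa: "w \<noteq> a" "w' \<noteq> b" using D by auto
  have "F1 \<inter> G1 \<noteq> {}" "F2 \<inter> G1 \<noteq> {}" "F1 \<inter> G2 \<noteq> {}" "F2 \<inter> G2 \<noteq> {}"
    using meet F(1,2) G(1,2) by auto
  then obtain i j i' j' where ij: "i \<in> F1" "i \<in> G1" "j \<in> F2" "j \<in> G1" "i' \<in> F1" "i' \<in> G2" "j' \<in> F2" "j' \<in> G2"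
    by blast
  have wa_ij: "{i, j, i', j'} \<inter> {w, a, w', b} = {}" using ij F G by auto
  have linF: "z \<notin> F2" if "z \<in> F1" "z \<notin> {w, a}" for z
    using linear[of F1 w a z F2] F that wa by auto
  have linG: "z \<notin> G2" if "z \<in> G1" "z \<notin> {w', b}" for z
    using linear[of G1 w' b z G2] G that wa by auto
  have ne: "i \<noteq> j" "i \<noteq> j'" "i' \<noteq> j" "i' \<noteq> j'" "i \<noteq> i'" "j \<noteq> j'"
    using linF linG ij wa_ij by auto
  have "F1 = {w, a, i, i'}" using member_eq[OF F(1,4,5)] ij ne wa wa_ij by auto
  moreover have "F2 = {w, a, j, j'}" using member_eq[OF F(2,6,7)] ij ne wa wa_ij by auto
  ultimately have n: "{w, a, i, i'} \<in> \<A>" "{w, a, j, j'} \<in> \<A>" using F by auto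
  have "distinct [w, a, i, i', j, j']" using wa ne wa_ij by auto
  then obtain B1 B2 where B: "B1 \<in> \<A>" "B2 \<in> \<A>" "B1 \<noteq> B2" "i \<in> B1" "j \<in> B1" "i \<in> B2" "j \<in> B2"
    "B1 \<inter> {w, a, i', j'} = {}" "B2 \<inter> {w, a, i', j'} = {}"
    using pair_word[OF n] by metis
  have G2: "G2 = {w', b, i', j'}" using member_eq[OF G(2,6,7)] ij ne wa wa_ij by auto
  have "B = G1" if "B \<in> \<A>" "i \<in> B" "j \<in> B" "B \<inter> {w, a, i', j'} = {}" for B
  proof -
    have "w' \<in> B \<or> b \<in> B" using meet[OF that(1) G(2)] that(4) G2 by auto
    then show ?thesis
      using linear[of B i j w' G1] linear[of B i j b G1] that G ij ne wa_ij by auto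
  qed
  then show False using B by metis
qed

lemma common_point:
  assumes "A \<in> \<A>" "B \<in> \<A>" "u \<in> A" "v \<in> A" "u \<in> B" "v \<in> B" "u \<noteq> v"
  shows "A = B"
proof (rule ccontr)
  assume ne: "A \<noteq> B"
  obtain p p' where p: "A = {u, v, p, p'}" "distinct [u, v, p, p']" by (rule pair_eq[OF assms(1,3,4,7)])
  obtain q q' where q: "B = {u, v, q, q'}" "distinct [u, v, q, q']" by (rule pair_eq[OF assms(2,5,6,7)])
  have "z \<notin> B" if "z \<in> A" "z \<noteq> u" "z \<noteq> v" for z
    using linear[of A u v z B] ne assms that by auto
  then have "p \<notin> B" "p' \<notin> B" using p by auto
  then have "distinct [u, v, p, p', q, q']" using p(2) q by auto
  then show False using no_two_edges assms p(1) q(1) by blast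
qed

lemma family_empty: "\<A> = {}"
proof (rule ccontr)
  assume "\<A> \<noteq> {}"
  then obtain A where A: "A \<in> \<A>" by blast
  obtain x a b c where Ae: "A = {x, a, b, c}"
    using card_member[OF A] by (auto simp: card_Suc_eq numeral_eq_Suc)
  have D: "distinct [x, a, b, c]" using distinct_member A Ae by blast
  have "{a, b, c, x} \<in> \<A>" "{x, b, c, a} \<in> \<A>" using A Ae by (auto simp: insert_commute)
  then have "4 \<le> card (off a b c)" "4 \<le> card (off x b c)" by (auto intro: card_off)
  then obtain C where "C \<in> off x b c" by fastforce
  then have C: "C \<in> \<A>" "a \<in> C" "C \<inter> A = {a}" using meet[OF A, of C] Ae by (auto simp: off_def)
  have "\<forall>B\<in>off a b c. \<exists>z. z \<in> B \<inter> C - {a}"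
    using meet[OF C(1)] by (fastforce simp: off_def)
  then obtain f where f: "\<And>B. B \<in> off a b c \<Longrightarrow> f B \<in> B \<inter> C - {a}" by metis
  have x: "x \<in> B \<and> B \<in> \<A>" if "B \<in> off a b c" for B
    using meet[OF A, of B] that Ae by (auto simp: off_def)
  have xC: "x \<notin> C" using C(3) Ae D by auto
  \<comment> \<open>Members missing \<open>a\<close>, \<open>b\<close>, \<open>c\<close> contain
    \<open>x\<close>, so equal images would give two common points.\<close>
  have "inj_on f (off a b c)"
  proof (rule inj_onI)
    fix B B' assume B: "B \<in> off a b c" "B' \<in> off a b c" and eq: "f B = f B'"
    have "x \<noteq> f B" using f[OF B(1)] xC by auto
    then show "B = B'" using common_point[of B B' x "f B"] x[OF B(1)] x[OF B(2)] f[OF B(1)] f[OF B(2)] eq by auto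
  qed
  then have "card (off a b c) \<le> card (C - {a})"
    by (rule card_inj_on_le) (use f finite_member[OF C(1)] in auto)
  also have "\<dots> = 3" using C card_member[OF C(1)] finite_member[OF C(1)] by simp
  finally show False using \<open>4 \<le> card (off a b c)\<close> by simp
qed

end

lemma exists_light_triple:
  fixes \<A> :: "'a set set"
  assumes "finite \<A>" "\<A> \<noteq> {}" "\<And>A. A \<in> \<A> \<Longrightarrow> card A = 4"
    and "\<And>A B. A \<in> \<A> \<Longrightarrow> B \<in> \<A> \<Longrightarrow> A \<inter> B \<noteq> {}"
  shows "\<exists>A\<in>\<A>. \<exists>S\<subseteq>A. card S = 3 \<and> card {B \<in> \<A>. B \<inter> S = {}} \<le> 3"
proof (rule ccontr)
  assume no: "\<not> ?thesis"
  have "4 \<le> card {B \<in> \<A>. B \<inter> S = {}}" if "A \<in> \<A>" "S \<subseteq> A" "card S = 3" for A S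
  proof -
    have "\<not> card {B \<in> \<A>. B \<inter> S = {}} \<le> 3" using no that by blast
    then show ?thesis by simp
  qed
  then interpret heavy_family \<A> using assms by unfold_locales auto
  show False using family_empty assms(2) by simp
qed

section \<open>Branching over transversals\<close>

definition deg :: "'a set set \<Rightarrow> 'a set \<Rightarrow> nat" where
  "deg H P = card {A \<in> H. P \<subseteq> A}"

lemma deg_branch:
  assumes "finite H" "finite G" "\<And>A. A \<in> H \<Longrightarrow> A \<inter> G \<noteq> {}" "\<And>x. x \<in> G \<Longrightarrow> deg H (insert x P) \<le> M"
  shows "deg H P \<le> card G * M"
proof -
  have "{A \<in> H. P \<subseteq> A} \<subseteq> (\<Union>x\<in>G. {A \<in> H. insert x P \<subseteq> A})"
  proof
    fix A assume A: "A \<in> {A \<in> H. P \<subseteq> A}"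
    then obtain x where "x \<in> A" "x \<in> G" using assms(3)[of A] by auto
    then show "A \<in> (\<Union>x\<in>G. {A \<in> H. insert x P \<subseteq> A})" using A by auto
  qed
  then have "deg H P \<le> card (\<Union>x\<in>G. {A \<in> H. insert x P \<subseteq> A})"
    unfolding deg_def using assms(1,2) by (intro card_mono) auto
  also have "\<dots> \<le> (\<Sum>x\<in>G. card {A \<in> H. insert x P \<subseteq> A})" by (rule card_UN_le[OF assms(2)])
  also have "\<dots> \<le> (\<Sum>x\<in>G. M)" using assms(4) by (intro sum_mono) (simp add: deg_def)
  finally show ?thesis by simp
qed

text \<open>Each step branches over a set \<open>G\<close> disjoint from \<open>P\<close>, so
  \<open>P\<close> grows by exactly one point and \<open>j\<close> steps reach size
  \<open>t\<close>. A set inside no member of \<open>H\<close> has degree 0, which is why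
  \<open>step\<close> concerns only the others.\<close>

lemma deg_iterate:
  assumes H: "finite H"
    and step: "\<And>P. finite P \<Longrightarrow> card P < t \<Longrightarrow> \<exists>A\<in>H. P \<subseteq> A \<Longrightarrow>
      \<exists>G. finite G \<and> card G \<le> c \<and> G \<inter> P = {} \<and> (\<forall>A\<in>H. A \<inter> G \<noteq> {})"
    and leaf: "\<And>Q. finite Q \<Longrightarrow> card Q = t \<Longrightarrow> deg H Q \<le> M"
  shows "finite P \<Longrightarrow> card P + j = t \<Longrightarrow> deg H P \<le> c ^ j * M"
proof (induction j arbitrary: P)
  case 0
  then show ?case using leaf by simp
next
  case (Suc j)
  show ?case
  proof (cases "\<exists>A\<in>H. P \<subseteq> A")
    case False
    then have "{A \<in> H. P \<subseteq> A} = {}" by blast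
    then show ?thesis by (simp only: deg_def card.empty)
  next
    case True
    then obtain G where G: "finite G" "card G \<le> c" "G \<inter> P = {}" "\<forall>A\<in>H. A \<inter> G \<noteq> {}"
      using step[OF Suc.prems(1)] Suc.prems(2) by auto
    have "deg H (insert x P) \<le> c ^ j * M" if "x \<in> G" for x
    proof -
      have "x \<notin> P" using that G(3) by blast
      then show ?thesis using Suc.IH[of "insert x P"] Suc.prems by simp
    qed
    then have "deg H P \<le> card G * (c ^ j * M)" using deg_branch[OF H G(1)] G(4) by blast
    also have "\<dots> \<le> c * (c ^ j * M)" using G(2) by (rule mult_le_mono1)
    finally show ?thesis by simp
  qed
qed

text \<open>Removing \<open>P\<close> maps the counted members injectively to sets of points outside
  \<open>S\<close> and \<open>P\<close>.\<close>

lemma deg_le_binom: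
  fixes S :: "nat set"
  assumes H: "\<And>A. A \<in> H \<Longrightarrow> A \<subseteq> {1..n} \<and> card A = k \<and> A \<inter> S = {}"
    and S: "S \<subseteq> {1..n}" "card S = 3"
  shows "deg H P \<le> binom (n - 3 - card P) (int k - int (card P))"
proof (cases "\<exists>A\<in>H. P \<subseteq> A")
  case False
  then have "{A \<in> H. P \<subseteq> A} = {}" by blast
  then show ?thesis by (simp only: deg_def card.empty)
next
  case True
  then obtain A where A: "A \<in> H" "P \<subseteq> A" by blast
  have fA: "finite A" if "A \<in> H" for A using H[OF that] finite_subset by blast
  have fP: "finite P" using fA[OF A(1)] A(2) finite_subset by blast
  have cP: "card P \<le> k" using card_mono[OF fA[OF A(1)] A(2)] H[OF A(1)] by simp
  let ?Y = "{1..n} - S - P"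
  have "P \<subseteq> {1..n} - S" using A H[OF A(1)] by blast
  then have "card ?Y = card ({1..n} - S) - card P" using fP by (rule card_Diff_subset[rotated])
  moreover have "card ({1..n} - S) = n - 3"
    using S finite_subset[OF S(1)] by (simp add: card_Diff_subset)
  ultimately have Y: "card ?Y = n - 3 - card P" by simp
  have "inj_on (\<lambda>A. A - P) {A \<in> H. P \<subseteq> A}" by (rule inj_onI) blast
  moreover have "(\<lambda>A. A - P) ` {A \<in> H. P \<subseteq> A} \<subseteq> {B. B \<subseteq> ?Y \<and> card B = k - card P}"
    using H fP by (auto simp: card_Diff_subset)
  ultimately have "deg H P \<le> card {B. B \<subseteq> ?Y \<and> card B = k - card P}"
    unfolding deg_def by (rule card_inj_on_le) simp
  also have "\<dots> = (n - 3 - card P) choose (k - card P)" using n_subsets[of ?Y] Y by simp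
  also have "\<dots> = binom (n - 3 - card P) (int k - int (card P))"
  proof -
    have "int k - int (card P) = int (k - card P)" using cP by simp
    then show ?thesis by (simp add: binom_def del: of_nat_diff)
  qed
  finally show ?thesis .
qed

text \<open>With \<open>N = n - 3 - p\<close> and \<open>K = k - p\<close>, absorption gives the
  ratio \<open>N / K\<close>; moreover \<open>71 * k * K \<le> N\<close>, because the loss
  \<open>3 + p\<close> is covered by \<open>71 * k * p\<close>.\<close>

lemma binom_step:
  assumes "71 * k\<^sup>2 \<le> n" "1 \<le> p"
  shows "71 * k * binom (n - 3 - Suc p) (int k - int (Suc p)) \<le> binom (n - 3 - p) (int k - int p)"
proof (cases "p < k")
  case False
  then show ?thesis by (simp add: binom_def)
next
  case True
  let ?N = "n - 3 - p" and ?K = "k - p"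
  have "71 * k * ?K \<le> ?N"
  proof -
    have "71 * k * ?K + 71 * k * p = 71 * k * (?K + p)" by (simp only: distrib_left)
    also have "\<dots> = 71 * k\<^sup>2" using True by (simp add: power2_eq_square)
    finally have "71 * k * ?K + 71 * k * p = 71 * k\<^sup>2" .
    moreover have "3 + p \<le> 71 * k * p"
    proof -
      have "4 * p \<le> 71 * k * p" using True by (intro mult_le_mono1) simp
      then show ?thesis using assms(2) by linarith
    qed
    ultimately show ?thesis using assms(1) by linarith
  qed
  have K: "0 < ?K" using True by simp
  have "?K * (71 * k * (?N - 1 choose (?K - 1))) = 71 * k * ?K * (?N - 1 choose (?K - 1))" by simp
  also have "\<dots> \<le> ?N * (?N - 1 choose (?K - 1))" using \<open>71 * k * ?K \<le> ?N\<close> by (rule mult_le_mono1)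
  also have "\<dots> = ?K * (?N choose ?K)" using times_binomial_minus1_eq[OF K] by simp
  finally have "71 * k * (?N - 1 choose (?K - 1)) \<le> ?N choose ?K" using K by simp
  moreover have "nat (int k - int (Suc p)) = ?K - 1" "nat (int k - int p) = ?K" using True by auto
  ultimately show ?thesis using True by (simp add: binom_def)
qed

text \<open>For \<open>l = j + 6\<close> this is \<open>l ^ 4 \<le> 71 ^ (l - 4)\<close>, which pays
  for four branchings over transversals. In the induction the base at most doubles, costing a factor
  16.\<close>

lemma fourth_power_le: "(j + 6) ^ 4 \<le> (71::nat) ^ (j + 2)"
proof (induction j)
  case (Suc j)
  have "(Suc j + 6) ^ 4 \<le> (2 * (j + 6)) ^ 4" by (rule power_mono) auto
  also have "\<dots> = 16 * (j + 6) ^ 4" by (simp only: power_mult_distrib) simp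
  also have "\<dots> \<le> 71 * 71 ^ (j + 2)" using Suc.IH by (intro mult_le_mono) auto
  finally show ?case by simp
qed simp

section \<open>Transversals of a maximal intersecting family\<close>

locale saturated_family =
  fixes n k :: nat and F :: "nat set set"
  assumes k4: "4 \<le> k" and large: "71 * k\<^sup>2 \<le> n"
    and uniform: "A \<in> F \<Longrightarrow> A \<subseteq> {1..n} \<and> card A = k"
    and intersect: "A \<in> F \<Longrightarrow> B \<in> F \<Longrightarrow> A \<inter> B \<noteq> {}"
    and saturated: "G \<subseteq> {1..n} \<Longrightarrow> card G = k \<Longrightarrow> (\<And>A. A \<in> F \<Longrightarrow> A \<inter> G \<noteq> {}) \<Longrightarrow> G \<in> F"
    and no_transversal_triple: "S \<subseteq> {1..n} \<Longrightarrow> card S = 3 \<Longrightarrow> \<exists>A\<in>F. A \<inter> S = {}"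
begin

text \<open>\<open>u p\<close> bounds the number of members that contain a given \<open>p\<close>-set and avoid a given triple.\<close>
definition u :: "nat \<Rightarrow> nat" where
  "u p = binom (n - 3 - p) (int k - int p)"

definition transversal :: "nat set \<Rightarrow> bool" where
  "transversal P \<longleftrightarrow> (\<forall>A\<in>F. A \<inter> P \<noteq> {})"

definition transversals :: "nat \<Rightarrow> nat set set" where
  "transversals i = {P. P \<subseteq> {1..n} \<and> card P \<le> i \<and> transversal P}"

lemma k_le_n: "k + 4 \<le> n"
proof -
  have "k * 1 \<le> k * k" by (rule mult_le_mono2) (use k4 in simp)
  then show ?thesis using large k4 unfolding power2_eq_square by linarith
qed

lemma finite_F: "finite F"
  by (rule finite_subset[of _ "Pow {1..n}"]) (use uniform in auto)

lemma finite_avoid: "finite (avoid F S)"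
  using finite_F by (simp add: avoid_def)

lemma obtain_triple:
  assumes "finite P" "card P \<le> 3" "P \<subseteq> X" "X \<subseteq> {1..n}" "3 \<le> card X"
  obtains S where "P \<subseteq> S" "S \<subseteq> X" "card S = 3"
  using exists_subset_between[of P 3 X] assms finite_subset[of X "{1..n}"] by auto

lemma extend_triple:
  assumes "finite P" "card P \<le> 3"
  obtains S where "P \<inter> {1..n} \<subseteq> S" "S \<subseteq> {1..n}" "card S = 3"
proof -
  have "card (P \<inter> {1..n}) \<le> 3" using assms card_mono[of P "P \<inter> {1..n}"] by simp
  then show ?thesis using obtain_triple[of "P \<inter> {1..n}" "{1..n}"] assms(1) that k_le_n by auto
qed

lemma no_small_transversal:
  assumes "finite P" "card P \<le> 3"
  shows "\<not> transversal P"
proof -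
  obtain S where S: "P \<inter> {1..n} \<subseteq> S" "S \<subseteq> {1..n}" "card S = 3" using assms by (rule extend_triple)
  obtain A where "A \<in> F" "A \<inter> S = {}" using no_transversal_triple[OF S(2,3)] by blast
  then have "A \<inter> P = {}" using S(1) uniform[of A] by blast
  then show ?thesis using \<open>A \<in> F\<close> by (auto simp: transversal_def)
qed

lemma finite_transversal: "P \<in> transversals i \<Longrightarrow> finite P"
  using finite_subset by (auto simp: transversals_def)

lemma card_transversal: "P \<in> transversals i \<Longrightarrow> 4 \<le> card P"
  using no_small_transversal[OF finite_transversal, of P i] by (fastforce simp: transversals_def)

text \<open>If they were disjoint, \<open>P\<close> would extend to a \<open>k\<close>-set
  \<open>G\<close> missing \<open>Q\<close>. Maximality puts \<open>G\<close> into \<open>F\<close>,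
  but \<open>Q\<close> has to meet every member.\<close>

lemma transversals_intersect:
  assumes "P \<in> transversals 4" "Q \<in> transversals 4"
  shows "P \<inter> Q \<noteq> {}"
proof
  assume disj: "P \<inter> Q = {}"
  have PQ: "P \<subseteq> {1..n}" "card P \<le> 4" "transversal P" "Q \<subseteq> {1..n}" "card Q \<le> 4" "transversal Q"
    using assms by (auto simp: transversals_def)
  have "card ({1..n} - Q) = n - card Q" using PQ(4) finite_subset by (subst card_Diff_subset) auto
  then have "\<exists>G. P \<subseteq> G \<and> G \<subseteq> {1..n} - Q \<and> card G = k"
    using PQ disj k4 k_le_n by (intro exists_subset_between) auto
  then obtain G where G: "P \<subseteq> G" "G \<subseteq> {1..n} - Q" "card G = k" by blast
  have "A \<inter> G \<noteq> {}" if "A \<in> F" for A using G(1) PQ(3) that unfolding transversal_def by blast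
  then have "G \<in> F" using G(2,3) by (intro saturated) auto
  then show False using PQ(6) G(2) by (auto simp: transversal_def)
qed

lemma avoid_bound:
  assumes "H \<subseteq> avoid F S" "S \<subseteq> {1..n}" "card S = 3"
  shows "deg H P \<le> u (card P)"
  unfolding u_def by (rule deg_le_binom[OF _ assms(2,3)]) (use assms(1) uniform in \<open>auto simp: avoid_def\<close>)

lemma u_step: "1 \<le> p \<Longrightarrow> 71 * k * u (Suc p) \<le> u p"
  unfolding u_def using large by (rule binom_step)

lemma u_power: "1 \<le> p \<Longrightarrow> (71 * k) ^ j * u (p + j) \<le> u p"
proof (induction j)
  case (Suc j)
  have "(71 * k) ^ Suc j * u (p + Suc j) = (71 * k) ^ j * (71 * k * u (Suc (p + j)))" by simp
  also have "\<dots> \<le> (71 * k) ^ j * u (p + j)" using Suc.prems u_step by (intro mult_le_mono2) simp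
  also have "\<dots> \<le> u p" using Suc by simp
  finally show ?case .
qed simp

text \<open>While \<open>P\<close> is no transversal, some member of \<open>F\<close> misses it; as
  \<open>F\<close> is intersecting, this member can be branched over at the cost of a factor
  \<open>k\<close>.\<close>

lemma deg_extend:
  assumes H: "H \<subseteq> avoid F S" and S: "S \<subseteq> {1..n}" "card S = 3"
    and no: "\<And>P A. finite P \<Longrightarrow> card P < m \<Longrightarrow> A \<in> H \<Longrightarrow> P \<subseteq> A \<Longrightarrow> \<not> transversal P"
    and Q: "finite Q" "card Q + j = m"
  shows "deg H Q \<le> k ^ j * u m"
proof (rule deg_iterate[OF _ _ _ Q])
  show "finite H" using H finite_avoid finite_subset by blast
next
  fix P assume P: "finite P" "card P < m" "\<exists>A\<in>H. P \<subseteq> A"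
  then have "\<not> transversal P" using no by blast
  then obtain A where A: "A \<in> F" "A \<inter> P = {}" by (auto simp: transversal_def)
  have "\<forall>B\<in>H. B \<inter> A \<noteq> {}" using H A(1) intersect by (auto simp: avoid_def)
  moreover have "finite A" "card A = k" using uniform[OF A(1)] finite_subset by auto
  ultimately show "\<exists>G. finite G \<and> card G \<le> k \<and> G \<inter> P = {} \<and> (\<forall>A\<in>H. A \<inter> G \<noteq> {})"
    using A(2) by (intro exI[of _ A]) simp
next
  fix Q :: "nat set" assume "card Q = m"
  then show "deg H Q \<le> u m" using avoid_bound[OF H S, of Q] by simp
qed

text \<open>\<open>rich i\<close> says that the family of transversals of size at most \<open>i\<close> has covering number at least 4.\<close>
definition rich :: "nat \<Rightarrow> bool" where
  "rich i \<longleftrightarrow> (\<forall>P. finite P \<longrightarrow> card P \<le> 3 \<longrightarrow> (\<exists>G\<in>transversals i. G \<inter> P = {}))"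

text \<open>Richness supplies a transversal of size at most \<open>l\<close> disjoint from any set
  of at most three points, so branching up to size 4 costs only a factor \<open>l\<close> each
  time.\<close>

lemma deg_rich:
  assumes "rich l" and H: "H \<subseteq> avoid F S"
    and M: "\<And>Q. finite Q \<Longrightarrow> card Q = 4 \<Longrightarrow> deg H Q \<le> M"
    and P: "finite P" "card P + j = 4"
  shows "deg H P \<le> l ^ j * M"
proof (rule deg_iterate[OF _ _ _ P])
  show "finite H" using H finite_avoid finite_subset by blast
next
  fix P :: "nat set" assume "finite P" "card P < 4"
  then obtain G where G: "G \<in> transversals l" "G \<inter> P = {}" using assms(1) by (force simp: rich_def)
  then show "\<exists>G. finite G \<and> card G \<le> l \<and> G \<inter> P = {} \<and> (\<forall>A\<in>H. A \<inter> G \<noteq> {})"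
    using H finite_transversal[OF G(1)] by (intro exI[of _ G]) (auto simp: transversals_def transversal_def avoid_def)
qed (rule M)

text \<open>The members of \<open>F\<close> are themselves transversals of size
  \<open>k\<close>.\<close>

lemma rich_k: "rich k"
  unfolding rich_def
proof (intro allI impI)
  fix P :: "nat set" assume "finite P" "card P \<le> 3"
  then obtain A where A: "A \<in> F" "A \<inter> P = {}"
    using no_small_transversal by (force simp: transversal_def)
  then have "A \<in> transversals k" using uniform[OF A(1)] intersect by (auto simp: transversals_def transversal_def)
  then show "\<exists>G\<in>transversals k. G \<inter> P = {}" using A(2) by blast
qed

lemma rich_ge_4: "rich l \<Longrightarrow> 4 \<le> l"
proof -
  assume "rich l"
  then obtain G where "G \<in> transversals l" by (force simp: rich_def dest: spec[of _ "{}"])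
  then show ?thesis using card_transversal[of G l] by (auto simp: transversals_def)
qed

lemma not_rich_triple:
  assumes "\<not> rich i"
  obtains S where "S \<subseteq> {1..n}" "card S = 3" "\<forall>G\<in>transversals i. G \<inter> S \<noteq> {}"
proof -
  obtain P where P: "finite P" "card P \<le> 3" "\<forall>G\<in>transversals i. G \<inter> P \<noteq> {}"
    using assms by (auto simp: rich_def)
  obtain S where S: "P \<inter> {1..n} \<subseteq> S" "S \<subseteq> {1..n}" "card S = 3" using P(1,2) by (rule extend_triple)
  have "G \<inter> S \<noteq> {}" if "G \<in> transversals i" for G
    using bspec[OF P(3) that] that S(1) by (auto simp: transversals_def)
  then show ?thesis using that S by blast
qed

lemma blocked:
  assumes "\<forall>G\<in>transversals i. G \<inter> S \<noteq> {}" "A \<in> avoid F S" "P \<subseteq> A" "card P \<le> i"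
  shows "\<not> transversal P"
  using assms(1) assms(2-4) uniform[of A] by (auto simp: transversals_def avoid_def)

lemma deg_blocked:
  assumes S: "S \<subseteq> {1..n}" "card S = 3" and block: "\<forall>G\<in>transversals i. G \<inter> S \<noteq> {}"
    and Q: "finite Q" "card Q + j = m" "m = Suc i"
  shows "deg (avoid F S) Q \<le> k ^ j * u m"
proof (rule deg_extend[OF order_refl S _ Q(1,2)])
  fix P A assume "card P < m" "A \<in> avoid F S" "P \<subseteq> A"
  then show "\<not> transversal P" using blocked[OF block] Q(3) by simp
qed

section \<open>The three ranges of the least rich index\<close>

lemma card_avoid: "card (avoid F S) = deg (avoid F S) {}"
  by (simp add: deg_def)

text \<open>Four branchings over transversals and \<open>l - 4\<close> over members give
  \<open>l ^ 4 * k ^ (l - 4) * u l\<close>. By \<open>fourth_power_le\<close> the factor is at most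
  \<open>(71 * k) ^ (l - 4)\<close>, which \<open>u_power\<close> absorbs into
  \<open>u 4\<close>.\<close>

lemma bound_large:
  assumes l: "rich l" "\<not> rich (l - 1)" "6 \<le> l"
  shows "\<exists>S\<subseteq>{1..n}. card S = 3 \<and> card (avoid F S) \<le> 3 * u 4 + 108 * k * u 5"
proof -
  obtain S where S: "S \<subseteq> {1..n}" "card S = 3" "\<forall>G\<in>transversals (l - 1). G \<inter> S \<noteq> {}"
    using l(2) by (rule not_rich_triple)
  define j where "j = l - 6"
  have lj: "l = j + 6" using l(3) by (simp add: j_def)
  have "deg (avoid F S) Q \<le> k ^ (j + 2) * u l" if "finite Q" "card Q = 4" for Q
    using deg_blocked[OF S that(1), of "j + 2" l] that(2) lj by simp
  then have "card (avoid F S) \<le> l ^ 4 * (k ^ (j + 2) * u l)"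
    unfolding card_avoid by (rule deg_rich[OF l(1) order_refl]) auto
  also have "\<dots> \<le> 71 ^ (j + 2) * (k ^ (j + 2) * u l)"
    unfolding lj by (rule mult_le_mono1[OF fourth_power_le])
  also have "\<dots> = (71 * k) ^ (j + 2) * u (4 + (j + 2))"
    unfolding lj power_mult_distrib by (simp add: add.commute)
  also have "\<dots> \<le> u 4" by (rule u_power) simp
  finally have "card (avoid F S) \<le> u 4" .
  then show ?thesis using S(1,2) by (intro exI[of _ S]) simp
qed

text \<open>The bound is at least \<open>(213 + 108) * k * u 5\<close>, while plain branching would
  cost \<open>5 ^ 4 * k * u 5\<close>. If the transversals of size 4 have a common point or do not
  exist, choosing \<open>S\<close> inside a transversal of size at most 5 makes the first factor 2,
  in total 250. Otherwise they supply two factors 3, in total 225.\<close>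

lemma bound_5:
  assumes l: "rich 5" "\<not> rich 4"
  shows "\<exists>S\<subseteq>{1..n}. card S = 3 \<and> card (avoid F S) \<le> 3 * u 4 + 108 * k * u 5"
proof -
  have u4: "71 * (k * u 5) \<le> u 4" using u_step[of 4] by (simp add: mult.assoc)
  have leaf: "deg (avoid F S) Q \<le> k * u 5" if "S \<subseteq> {1..n}" "card S = 3"
    "\<forall>G\<in>transversals 4. G \<inter> S \<noteq> {}" "finite Q" "card Q = 4" for S Q
  proof -
    have "card Q + 1 = 5" using that(5) by simp
    then have "deg (avoid F S) Q \<le> k ^ 1 * u 5" by (rule deg_blocked[OF that(1-4)]) simp
    then show ?thesis by simp
  qed
  have two: ?thesis if B: "B \<in> transversals 5" "P \<subseteq> B" "card P \<le> 1"
    "\<forall>G\<in>transversals 4. G \<inter> P \<noteq> {}" for B P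
  proof -
    have B': "finite B" "card B \<le> 5" "B \<subseteq> {1..n}" "4 \<le> card B" "transversal B"
      using finite_transversal[OF B(1)] card_transversal[OF B(1)] B(1) by (simp_all add: transversals_def)
    obtain S where S: "P \<subseteq> S" "S \<subseteq> B" "card S = 3"
      using obtain_triple[of P B] B B' finite_subset[OF B(2) B'(1)] by auto
    have S': "S \<subseteq> {1..n}" "\<forall>G\<in>transversals 4. G \<inter> S \<noteq> {}" using S B' B(4) by blast+
    note leaf' = leaf[OF S'(1) S(3) S'(2)]
    have "card (avoid F S) \<le> card (B - S) * (5 ^ 3 * (k * u 5))"
      unfolding card_avoid
    proof (rule deg_branch[OF finite_avoid])
      show "finite (B - S)" using B' by simp
      show "A \<inter> (B - S) \<noteq> {}" if "A \<in> avoid F S" for A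
        using that B'(5) by (auto simp: avoid_def transversal_def)
      show "deg (avoid F S) {x} \<le> 5 ^ 3 * (k * u 5)" for x
        by (rule deg_rich[OF l(1) order_refl leaf']) auto
    qed
    also have "\<dots> \<le> 2 * (5 ^ 3 * (k * u 5))"
      using B' S finite_subset[OF S(2)] by (intro mult_le_mono1) (simp add: card_Diff_subset)
    finally have "card (avoid F S) \<le> 250 * (k * u 5)" by simp
    then have "card (avoid F S) \<le> 3 * u 4 + 108 * k * u 5" using u4 by linarith
    then show ?thesis using S'(1) S(3) by blast
  qed
  show ?thesis
  proof (cases "\<exists>x. \<forall>G\<in>transversals 4. x \<in> G")
    case True
    then obtain x where x: "\<And>G. G \<in> transversals 4 \<Longrightarrow> x \<in> G" by blast
    show ?thesis
    proof (cases "transversals 4 = {}")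
      case True
      obtain B where "B \<in> transversals 5" using l(1) by (force simp: rich_def dest: spec[of _ "{}"])
      then show ?thesis using True by (intro two[of B "{}"]) auto
    next
      case False
      then obtain B where B: "B \<in> transversals 4" by blast
      then have "B \<in> transversals 5" by (auto simp: transversals_def)
      then show ?thesis using x B by (intro two[of B "{x}"]) auto
    qed
  next
    case False
    obtain S where S: "S \<subseteq> {1..n}" "card S = 3" "\<forall>G\<in>transversals 4. G \<inter> S \<noteq> {}"
      using l(2) by (rule not_rich_triple)
    \<comment> \<open>\<open>S\<close> meets every transversal of size at most 4, so at most three
      points of each lie outside \<open>S\<close>.\<close>
    have G3: "finite (G - S)" "card (G - S) \<le> 3" "\<And>A. A \<in> avoid F S \<Longrightarrow> A \<inter> (G - S) \<noteq> {}"
      if "G \<in> transversals 4" for G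
    proof -
      have "finite G" "card G \<le> 4" "transversal G"
        using finite_transversal[OF that] that by (simp_all add: transversals_def)
      moreover have "G - S \<subset> G" using bspec[OF S(3) that] by blast
      ultimately show "finite (G - S)" "card (G - S) \<le> 3" "\<And>A. A \<in> avoid F S \<Longrightarrow> A \<inter> (G - S) \<noteq> {}"
        using psubset_card_mono[of G "G - S"] by (auto simp: avoid_def transversal_def)
    qed
    have step: "deg (avoid F S) P \<le> 3 * M" if "G \<in> transversals 4"
      "\<And>x. x \<in> G - S \<Longrightarrow> deg (avoid F S) (insert x P) \<le> M" for G P M
    proof -
      have "deg (avoid F S) P \<le> card (G - S) * M"
        by (rule deg_branch[OF finite_avoid G3(1)[OF that(1)] G3(3)[OF that(1)] that(2)])
      also have "\<dots> \<le> 3 * M" using G3(2)[OF that(1)] by (rule mult_le_mono1)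
      finally show ?thesis .
    qed
    have "deg (avoid F S) {x} \<le> 3 * (5 ^ 2 * (k * u 5))" for x
    proof -
      \<comment> \<open>No point is common to these transversals, so the second branching can use
        one that misses \<open>x\<close>.\<close>
      obtain G where G: "G \<in> transversals 4" "x \<notin> G" using False by blast
      show ?thesis
      proof (rule step[OF G(1)])
        fix y assume "y \<in> G - S"
        then have "y \<noteq> x" using G(2) by blast
        then have "card {y, x} + 2 = 4" by simp
        then show "deg (avoid F S) {y, x} \<le> 5 ^ 2 * (k * u 5)"
          by (intro deg_rich[OF l(1) order_refl leaf[OF S]]) auto
      qed
    qed
    note two_steps = this
    obtain G where "G \<in> transversals 4" using False by blast
    then have "card (avoid F S) \<le> 3 * (3 * (5 ^ 2 * (k * u 5)))"
      unfolding card_avoid by (rule step) (rule two_steps)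
    then have "card (avoid F S) \<le> 3 * u 4 + 108 * k * u 5" using u4 by simp
    then show ?thesis using S(1,2) by blast
  qed
qed

text \<open>Take a light triple \<open>S\<close> inside a transversal \<open>A\<close>. The at most
  three transversals of size 4 avoiding \<open>S\<close> account for \<open>3 * u 4\<close>. The
  remaining members contain no transversal of size at most 4, and as \<open>A - S\<close> is a
  single point there are at most \<open>4 ^ 3 * k * u 5\<close> of them.\<close>

lemma bound_4:
  assumes l: "rich 4"
  shows "\<exists>S\<subseteq>{1..n}. card S = 3 \<and> card (avoid F S) \<le> 3 * u 4 + 108 * k * u 5"
proof -
  let ?T = "transversals 4"
  have fin: "finite ?T" by (rule finite_subset[of _ "Pow {1..n}"]) (auto simp: transversals_def)
  have c4: "card G = 4" if "G \<in> ?T" for G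
    using card_transversal[OF that] that by (auto simp: transversals_def)
  obtain B where "B \<in> ?T" using l by (force simp: rich_def dest: spec[of _ "{}"])
  then have "\<exists>A\<in>?T. \<exists>S\<subseteq>A. card S = 3 \<and> card {B \<in> ?T. B \<inter> S = {}} \<le> 3"
    using fin c4 transversals_intersect by (intro exists_light_triple) auto
  then obtain A S where A: "A \<in> ?T" and S: "S \<subseteq> A" "card S = 3" "card {B \<in> ?T. B \<inter> S = {}} \<le> 3"
    by blast
  let ?N = "{B \<in> ?T. B \<inter> S = {}}"
  have A': "finite A" "A \<subseteq> {1..n}" "transversal A"
    using finite_transversal[OF A] A by (simp_all add: transversals_def)
  then have S': "S \<subseteq> {1..n}" using S by blast
  define H where "H = {B \<in> avoid F S. \<forall>Q\<in>?N. \<not> Q \<subseteq> B}"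
  have H: "H \<subseteq> avoid F S" "finite H" using finite_avoid by (auto simp: H_def)
  have "\<not> transversal P" if P: "finite P" "card P < 5" "B \<in> H" "P \<subseteq> B" for P B
  proof
    assume "transversal P"
    then have "P \<in> ?N" using P uniform[of B] by (auto simp: H_def avoid_def transversals_def)
    then show False using P(3,4) by (auto simp: H_def)
  qed
  then have leaf: "deg H Q \<le> k * u 5" if "finite Q" "card Q = 4" for Q
    using deg_extend[OF H(1) S' S(2), of 5 Q 1] that by simp
  have "deg H {} \<le> card (A - S) * (4 ^ 3 * (k * u 5))"
  proof (rule deg_branch[OF H(2)])
    show "finite (A - S)" using A' by simp
    show "B \<inter> (A - S) \<noteq> {}" if "B \<in> H" for B
      using that A'(3) by (auto simp: H_def avoid_def transversal_def)
    show "deg H {x} \<le> 4 ^ 3 * (k * u 5)" for x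
      by (rule deg_rich[OF l H(1) leaf]) auto
  qed
  also have "card (A - S) = 1"
    using c4[OF A] S A'(1) finite_subset[OF S(1)] by (simp add: card_Diff_subset)
  finally have cH: "card H \<le> 64 * (k * u 5)" by (simp add: deg_def)
  have "avoid F S \<subseteq> H \<union> (\<Union>Q\<in>?N. {B \<in> avoid F S. Q \<subseteq> B})" by (auto simp: H_def)
  then have "card (avoid F S) \<le> card (H \<union> (\<Union>Q\<in>?N. {B \<in> avoid F S. Q \<subseteq> B}))"
    using finite_avoid H fin by (intro card_mono) auto
  also have "\<dots> \<le> card H + card (\<Union>Q\<in>?N. {B \<in> avoid F S. Q \<subseteq> B})" by (rule card_Un_le)
  also have "card (\<Union>Q\<in>?N. {B \<in> avoid F S. Q \<subseteq> B}) \<le> (\<Sum>Q\<in>?N. card {B \<in> avoid F S. Q \<subseteq> B})"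
    using fin by (intro card_UN_le) simp
  also have "\<dots> \<le> (\<Sum>Q\<in>?N. u 4)"
  proof (rule sum_mono)
    fix Q assume "Q \<in> ?N"
    then show "card {B \<in> avoid F S. Q \<subseteq> B} \<le> u 4"
      using avoid_bound[OF order_refl S' S(2), of Q] c4[of Q] by (simp add: deg_def)
  qed
  also have "\<dots> \<le> 3 * u 4" using S(3) by simp
  finally have "card (avoid F S) \<le> 3 * u 4 + 108 * k * u 5" using cH by simp
  then show ?thesis using S' S(2) by blast
qed

lemma light_triple: "\<exists>S\<subseteq>{1..n}. card S = 3 \<and> card (avoid F S) \<le> 3 * u 4 + 108 * k * u 5"
proof -
  define l where "l = (LEAST i. rich i)"
  have l: "rich l" unfolding l_def using rich_k by (rule LeastI)
  \<comment> \<open>\<open>l\<close> is at least 4, so \<open>l - 1\<close> is truly smaller and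
    minimality applies.\<close>
  have "\<not> rich (l - 1)" using rich_ge_4[OF l] not_less_Least[of "l - 1" rich] l_def by simp
  moreover have "l = 4 \<or> l = 5 \<or> 6 \<le> l" using rich_ge_4[OF l] by linarith
  ultimately show ?thesis using l bound_4 bound_5 bound_large by auto
qed

end

section \<open>Passing to a maximal family\<close>

lemma gamma3_le: "S \<subseteq> {1..n} \<Longrightarrow> card S = 3 \<Longrightarrow> gamma3 n F \<le> card (avoid F S)"
  unfolding gamma3_def
proof (rule Min_le)
  have "{card (avoid F S) |S. S \<subseteq> {1..n} \<and> card S = 3} \<subseteq> (\<lambda>S. card (avoid F S)) ` Pow {1..n}" by auto
  then show "finite {card (avoid F S) |S. S \<subseteq> {1..n} \<and> card S = 3}" by (rule finite_subset) simp
qed auto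

lemma extend_to_saturated:
  fixes F :: "nat set set"
  assumes "\<forall>A\<in>F. A \<subseteq> {1..n} \<and> card A = k" "intersecting F" "k \<noteq> 0"
  obtains F' where "F \<subseteq> F'" "\<forall>A\<in>F'. A \<subseteq> {1..n} \<and> card A = k" "intersecting F'"
    "\<And>G. G \<subseteq> {1..n} \<Longrightarrow> card G = k \<Longrightarrow> (\<And>A. A \<in> F' \<Longrightarrow> A \<inter> G \<noteq> {}) \<Longrightarrow> G \<in> F'"
proof -
  define X where "X = {F'. F \<subseteq> F' \<and> (\<forall>A\<in>F'. A \<subseteq> {1..n} \<and> card A = k) \<and> intersecting F'}"
  have fin: "finite X" by (rule finite_subset[of _ "Pow (Pow {1..n})"]) (auto simp: X_def)
  have "X \<noteq> {}" using assms by (auto simp: X_def)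
  then obtain F' where F'X: "F' \<in> X" and max: "\<forall>E\<in>X. F' \<subseteq> E \<longrightarrow> F' = E"
    using finite_has_maximal[OF fin] by blast
  then have F': "F \<subseteq> F'" "\<forall>A\<in>F'. A \<subseteq> {1..n} \<and> card A = k" "intersecting F'" by (auto simp: X_def)
  have "G \<in> F'" if G: "G \<subseteq> {1..n}" "card G = k" "\<And>A. A \<in> F' \<Longrightarrow> A \<inter> G \<noteq> {}" for G
  proof -
    \<comment> \<open>\<open>intersecting\<close> also compares a set with itself, hence the
      condition that \<open>k\<close> is not 0.\<close>
    have "G \<noteq> {}" using G(2) assms(3) by auto
    then have "intersecting (insert G F')" using F'(3) G(3) by (auto simp: intersecting_def)
    then have "insert G F' \<in> X" using F' G(1,2) by (auto simp: X_def)
    then have "F' = insert G F'" using max by blast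
    then show ?thesis by blast
  qed
  then show ?thesis using that F' by blast
qed

theorem theorem1p3:
  fixes n k :: nat and F :: "nat set set"
  assumes "k \<ge> 4" and "n \<ge> 71 * k^2"
    and "\<forall>A\<in>F. A \<subseteq> {1..n} \<and> card A = k"
    and "intersecting F"
  shows "gamma3 n F \<le> 3 * binom (n - 7) (int k - 4) + 108 * k * binom (n - 8) (int k - 5)"
proof -
  obtain F' where F': "F \<subseteq> F'" "\<forall>A\<in>F'. A \<subseteq> {1..n} \<and> card A = k" "intersecting F'"
    "\<And>G. G \<subseteq> {1..n} \<Longrightarrow> card G = k \<Longrightarrow> (\<And>A. A \<in> F' \<Longrightarrow> A \<inter> G \<noteq> {}) \<Longrightarrow> G \<in> F'"
    using extend_to_saturated[OF assms(3,4)] assms(1) by auto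
  have "\<exists>S\<subseteq>{1..n}. card S = 3 \<and>
      card (avoid F' S) \<le> 3 * binom (n - 7) (int k - 4) + 108 * k * binom (n - 8) (int k - 5)"
  proof (cases "\<exists>S\<subseteq>{1..n}. card S = 3 \<and> avoid F' S = {}")
    \<comment> \<open>A triple meeting every member is avoided by none, so the bound is
      trivial.\<close>
    case True
    then obtain S where S: "S \<subseteq> {1..n}" "card S = 3" "avoid F' S = {}" by blast
    have "card (avoid F' S) = 0" unfolding S(3) by simp
    then show ?thesis using S(1,2) by (intro exI[of _ S]) simp
  next
    case False
    have "\<exists>A\<in>F'. A \<inter> S = {}" if "S \<subseteq> {1..n}" "card S = 3" for S
      using False that unfolding avoid_def by blast
    then interpret saturated_family n k F'
      using F'(2,3,4) assms(1,2) by unfold_locales (simp_all add: intersecting_def)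
    show ?thesis using light_triple by (simp add: u_def)
  qed
  then obtain S where S: "S \<subseteq> {1..n}" "card S = 3"
    "card (avoid F' S) \<le> 3 * binom (n - 7) (int k - 4) + 108 * k * binom (n - 8) (int k - 5)" by blast
  have "finite F'" by (rule finite_subset[of _ "Pow {1..n}"]) (use F'(2) in auto)
  then have "card (avoid F S) \<le> card (avoid F' S)"
    using F'(1) by (intro card_mono) (auto simp: avoid_def)
  then show ?thesis using gamma3_le[OF S(1,2), of F] S(3) by linarith
qed

end
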